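(* For each $i\in\{1,\dots,N\}$, let the sequence $\{(w^i_t,D^i_t,z^i_t)\}_{t\ge1}$ be generated by the C-SP-SG algorithm (defined in the context) for the constrained optimization problem $$\min_{w^i\in\mathcal W_i\,\forall i,\;D\in\mathcal D}\ \sum_{i=1}^Nf^i(w^i,D)\quad\text{s.t.}\quad \sum_{i=1}^Ng^i(w^i,D)\le0,\qquad(\mathrm P)$$ over a sequence $\{\mathcal G_t\}_{t\ge1}$ of $B$-jointly connected, $\delta$-nondegenerate, weight-balanced digraphs on $\{1,\dots,N\}$ with $\sup_{t\ge1}\sigma_{\max}(\mathsf L_t)\le\overline\Lambda$. Let $d_{\max}:=\max\{d_{\mathrm{out},t}(k): k\in\{1,\dots,N\},\,t\in\mathbb Z_{\ge1}\}$, $\tilde\delta'\in(0,1)$, $\tilde\delta:=\min\{\tilde\delta',(1-\tilde\delta')\tfrac{\delta}{d_{\max}}\}$, and let $\sigma\in\big[\tfrac{\tilde\delta}{\delta},\tfrac{1-\tilde\delta}{d_{\max}}\big]$. Assume that the sets $\mathcal D$ and $\mathcal W_i$ are compact (besides being convex), and that the radius $r$ is such that the closed ball $\bar{\mathcal B}(0,r)$ contains the optimal dual set of $(\mathrm P)$. Assume also that, on $\mathcal W_i\times\mathcal D$, the subgradient sets are bounded as $$\partial_{w^i}f^i\subseteq\bar{\mathcal B}(0,H_{f,w}),\quad \partial_Df^i\subseteq\bar{\mathcal B}(0,H_{f,D}),\quad \partial_{w^i}g^i_l\subseteq\bar{\mathcal B}(0,H_{g,w}),\quad \partial_Dg^i_l\subseteq\bar{\mathcal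 B}(0,H_{g,D})$$ for all $i\in\{1,\dots,N\}$ and $l\in\{1,\dots,m\}$. Let $(\mathbf w^*,D^*,z^* )$ be any saddle point of the Lagrangian $$\mathcal L(\mathbf w,D,z)=\sum_{i=1}^N\big(f^i(w^i,D)+z^\top g^i(w^i,D)\big)$$ on $(\mathcal W_1\times\dots\times\mathcal W_N)\times\mathcal D\times\mathbb R^m_{\ge0}$. (The existence of such a saddle point implies that strong duality is attained.) Let the learning rates be chosen by the Doubling Trick: for each $m'=0,1,2,\dots$, $\eta_s=1/\sqrt{2^{m'}}$ for $s=2^{m'},\dots,2^{m'+1}-1$. Then, for every $t\ge2$, the running time-averages satisfy $$-\frac{\alpha_{\boldsymbol\mu,\mathbf z}+\alpha_{\mathbf w,\mathbf D}}{2\sqrt{t-1}}\le\phi(\mathbf w_t^{\mathrm{av}},\mathbf D_t^{\mathrm{av}},\mathbf z_t^{\mathrm{av}})-\mathcal L(\mathbf w^*,D^*,z^* )\le\frac{\alpha_{\mathbf w,\mathbf D}+\alpha_{\boldsymbol\mu,\mathbf z}}{2\sqrt{t-1}},$$ where $$\alpha_{\mathbf w,\mathbf D}:=\tfrac{\sqrt2}{\sqrt2-1}\Big(4(B_{\mathbf w}^2+B_{\mathbf D}^2)+6(H_{\mathbf w}^2+H_{\mathbf D}^2)+H_{\mathbf D}(3+\sigma\overline\Lambda)C_u(B_{\mathbf D}+2H_{\mathbf D})\Big),$$ $$\alpha_{\boldsymbol\mu,\mathbf z}:=\tfrac{\sqrt2}{\sqrt2-1}\Big(4(B_{\boldsymbol\mu}^2+B_{\mathbf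 z}^2)+6(H_{\boldsymbol\mu}^2+H_{\mathbf z}^2)+H_{\mathbf z}(3+\sigma\overline\Lambda)C_u(B_{\mathbf z}+2H_{\mathbf z})\Big),$$ $$C_u:=\frac{2^5/3^2}{1-\big(1-\frac{\tilde\delta}{4N^2}\big)^{1/B}},$$ with $B_{\boldsymbol\mu}=H_{\boldsymbol\mu}=0$, $B_{\mathbf z}=\sqrt N\,r$, $B_{\mathbf w}=\big(\sum_{i=1}^N\mathrm{diam}(\mathcal W_i)^2\big)^{1/2}$, $B_{\mathbf D}=\sqrt N\,\mathrm{diam}(\mathcal D)$, $H_{\mathbf w}^2=N(H_{f,w}+r\sqrt m\,H_{g,w})^2$, $H_{\mathbf D}^2=N(H_{f,D}+r\sqrt m\,H_{g,D})^2$, and $H_{\mathbf z}^2=\sum_{i=1}^N\big(\sup_{(w^i,D)\in\mathcal W_i\times\mathcal D}\|g^i(w^i,D)\|_2\big)^2$.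
   Context: **Problem data.** For each agent $i\in\{1,\dots,N\}$: $\mathcal W_i\subseteq\mathbb R^{n_i}$ and $\mathcal D\subseteq\mathbb R^{d_D}$ are convex sets; $f^i:\mathbb R^{n_i}\times\mathbb R^{d_D}\to\mathbb R$ is convex and $g^i=(g^i_1,\dots,g^i_m):\mathbb R^{n_i}\times\mathbb R^{d_D}\to\mathbb R^m$ has convex components. Vector inequalities are componentwise. With $\mathbf w=(w^1,\dots,w^N)$, $\mathbf D=(D^1,\dots,D^N)$, $\mathbf z=(z^1,\dots,z^N)$, set $$\phi(\mathbf w,\mathbf D,\mathbf z)=\sum_{i=1}^N\big(f^i(w^i,D^i)+(z^i)^\top g^i(w^i,D^i)\big).$$ The optimal dual set of $(\mathrm P)$ is the set of maximizers over $z\in\mathbb R^m_{\ge0}$ of $q(z)=\inf\{\mathcal L(\mathbf w,D,z): w^i\in\mathcal W_i\ \forall i,\ D\in\mathcal D\}$. A saddle point of $\mathcal L$ is a point $(\mathbf w^*,D^*,z^* )$ of the stated set with $\mathcal L(\mathbf w^*,D^*,z)\le\mathcal L(\mathbf w^*,D^*,z^* )\le\mathcal L(\mathbf w,D,z^* )$ for all $(\mathbf w,D,z)$ in that set. **Graphs.** A weighted digraph $\mathcal G_t$ on $\{1,\dots,N\}$ is given by an entrywise nonnegative adjacency matrix $\mathsf A_t=(\mathsf a_{ij,t})\in\mathbb R^{N\times N}$, with $(i,j)$ an edge iff $\mathsf a_{ij,t}>0$. $d_{\mathrm{out},t}(i)=\sum_j\mathsf a_{ij,t}$; the Laplacian is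 $\mathsf L_t=\mathrm{diag}(\mathsf A_t\mathbf 1_N)-\mathsf A_t$; $\mathcal G_t$ is weight-balanced if $\sum_j\mathsf a_{ij,t}=\sum_j\mathsf a_{ji,t}$ for all $i$. The sequence is $\delta$-nondegenerate ($\delta>0$) if $\mathsf a_{ij,t}>\delta$ whenever $\mathsf a_{ij,t}>0$; it is $B$-jointly connected ($B\in\mathbb Z_{\ge1}$) if for each $k\in\mathbb Z_{\ge1}$ the union digraph $\mathcal G_{kB}\cup\dots\cup\mathcal G_{(k+1)B-1}$ is strongly connected. $\sigma_{\max}$ is the largest singular value; $\mathrm{diam}$ is the Euclidean diameter. **C-SP-SG algorithm (Consensus-based Saddle-Point (Sub-)Gradient).** With initial values $w^i_1\in\mathbb R^{n_i}$, $D^i_1\in\mathbb R^{d_D}$, $z^i_1\in\mathbb R^m_{\ge0}$, each agent iterates $$\hat w^i_{t+1}=w^i_t-\eta_t\big(d_{f^i,w^i_t}+d_{g^i,w^i_t}^\top z^i_t\big),$$ $$\hat D^i_{t+1}=D^i_t+\sigma\sum_{j=1}^N\mathsf a_{ij,t}(D^j_t-D^i_t)-\eta_t\big(d_{f^i,D^i_t}+d_{g^i,D^i_t}^\top z^i_t\big),$$ $$\hat z^i_{t+1}=z^i_t+\sigma\sum_{j=1}^N\mathsf a_{ij,t}(z^j_t-z^i_t)+\eta_t\,g^i(w^i_t,D^i_t),$$ and sets $w^i_{t+1}=\mathcal P_{\mathcal W_i}(\hat w^i_{t+1})$, $D^i_{t+1}=\mathcal P_{\mathcal D}(\hat D^i_{t+1})$,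 $z^i_{t+1}=\mathcal P_{\mathbb R^m_{\ge0}\cap\bar{\mathcal B}(0,r)}(\hat z^i_{t+1})$, with $\mathcal P$ the Euclidean orthogonal projection, $\sigma>0$ the consensus stepsize, $\eta_t>0$ the learning rates. Here $d_{f^i,w^i_t}\in\partial_{w^i}f^i(w^i_t,D^i_t)$ and $d_{f^i,D^i_t}\in\partial_Df^i(w^i_t,D^i_t)$ are subgradients of $f^i$ with respect to the first and second arguments, respectively, and the matrices $d_{g^i,w^i_t}\in\mathbb R^{m\times n_i}$ and $d_{g^i,D^i_t}\in\mathbb R^{m\times d_D}$ contain in the $l$-th row an element of $\partial_{w^i}g^i_l(w^i_t,D^i_t)$ and of $\partial_Dg^i_l(w^i_t,D^i_t)$, respectively. $\partial_{w^i}$ and $\partial_D$ denote the sets of subgradients with respect to the first and second arguments. **Running time-averages.** With $\mathbf w_t=(w^1_t,\dots,w^N_t)$, etc., for $t\ge1$, $\mathbf w_{t+1}^{\mathrm{av}}=\frac1t\sum_{s=1}^t\mathbf w_s$, and likewise $\mathbf D_{t+1}^{\mathrm{av}}$, $\mathbf z_{t+1}^{\mathrm{av}}$.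
   Formalization: Two assumptions are added, as the claim fails without them: the initial values lie in W_i, D and the closed ball of radius r, and the chosen subgradients in w and D together form a subgradient of the jointly convex f^i (and of each g^i_l), not just separate partial subgradients. *)

theory Defs
  imports "HOL-Analysis.Analysis"
begin

(* The spaces \<real>^{n_i}, whose dimension depends on the agent i, are the coordinate subspaces
   coord_space (K i) of one ambient space real ^ 'k, where n_i = card (K i). Every finite family
   of dimensions n_i arises in this way, and norm, inner product, convexity, compactness,
   diameter and projection onto subsets agree with those of \<real>^{n_i}. *)
definition coord_space :: "'k::finite set \<Rightarrow> (real ^ 'k) set" where
  "coord_space K = {x. \<forall>j. j \<notin> K \<longrightarrow> x $ j = 0}"

definition nonneg_orthant :: "(real ^ 'm::finite) set" where
  "nonneg_orthant = {z. \<forall>l. 0 \<le> z $ l}"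

(* E is the (sub)space on which h is regarded as a convex function. *)
definition subdifferential :: "'v::real_inner set \<Rightarrow> ('v \<Rightarrow> real) \<Rightarrow> 'v \<Rightarrow> 'v set" where
  "subdifferential E h x = {v \<in> E. \<forall>y\<in>E. h x + v \<bullet> (y - x) \<le> h y}"

definition subdiff_fst ::
  "'u::real_inner set \<Rightarrow> ('u \<Rightarrow> 'v \<Rightarrow> real) \<Rightarrow> 'u \<Rightarrow> 'v \<Rightarrow> 'u set" where
  "subdiff_fst E h u v = subdifferential E (\<lambda>u'. h u' v) u"

definition subdiff_snd ::
  "('u \<Rightarrow> 'v::real_inner \<Rightarrow> real) \<Rightarrow> 'u \<Rightarrow> 'v \<Rightarrow> 'v set" where
  "subdiff_snd h u v = subdifferential UNIV (\<lambda>v'. h u v') v"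

(* (p, q) may fail to be a joint subgradient although p and q are partial ones: for
   h u v = 2 * abs (u - v) + u + v, both partial subdifferentials at (1, 1) contain 0, but (1, 1)
   is not a minimizer of h. *)
definition subdiff_joint ::
  "'u::real_inner set \<Rightarrow> ('u \<Rightarrow> 'v::real_inner \<Rightarrow> real) \<Rightarrow> 'u \<Rightarrow> 'v \<Rightarrow> ('u \<times> 'v) set" where
  "subdiff_joint E h u v = subdifferential (E \<times> UNIV) (\<lambda>(u', v'). h u' v') (u, v)"

definition phi ::
  "('a::finite \<Rightarrow> 'u \<Rightarrow> 'v \<Rightarrow> real) \<Rightarrow> ('a \<Rightarrow> 'u \<Rightarrow> 'v \<Rightarrow> real ^ 'm::finite) \<Rightarrow>
   ('a \<Rightarrow> 'u) \<Rightarrow> ('a \<Rightarrow> 'v) \<Rightarrow> ('a \<Rightarrow> real ^ 'm) \<Rightarrow> real" where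
  "phi f g w D z = (\<Sum>i\<in>UNIV. f i (w i) (D i) + z i \<bullet> g i (w i) (D i))"

definition lagrangian ::
  "('a::finite \<Rightarrow> 'u \<Rightarrow> 'v \<Rightarrow> real) \<Rightarrow> ('a \<Rightarrow> 'u \<Rightarrow> 'v \<Rightarrow> real ^ 'm::finite) \<Rightarrow>
   ('a \<Rightarrow> 'u) \<Rightarrow> 'v \<Rightarrow> real ^ 'm \<Rightarrow> real" where
  "lagrangian f g w D z = (\<Sum>i\<in>UNIV. f i (w i) D + z \<bullet> g i (w i) D)"

(* A real-valued infimum: it is only used for continuous f i, g i and nonempty compact W i, DD,
   where the Lagrangian is bounded below for every fixed z. *)
definition dual_function ::
  "('a::finite \<Rightarrow> 'u set) \<Rightarrow> 'v set \<Rightarrow> ('a \<Rightarrow> 'u \<Rightarrow> 'v \<Rightarrow> real) \<Rightarrow>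
   ('a \<Rightarrow> 'u \<Rightarrow> 'v \<Rightarrow> real ^ 'm::finite) \<Rightarrow> real ^ 'm \<Rightarrow> real" where
  "dual_function W DD f g z = Inf {lagrangian f g w D z | w D. (\<forall>i. w i \<in> W i) \<and> D \<in> DD}"

definition optimal_dual_set ::
  "('a::finite \<Rightarrow> 'u set) \<Rightarrow> 'v set \<Rightarrow> ('a \<Rightarrow> 'u \<Rightarrow> 'v \<Rightarrow> real) \<Rightarrow>
   ('a \<Rightarrow> 'u \<Rightarrow> 'v \<Rightarrow> real ^ 'm::finite) \<Rightarrow> (real ^ 'm) set" where
  "optimal_dual_set W DD f g =
     {z \<in> nonneg_orthant. \<forall>z'\<in>nonneg_orthant. dual_function W DD f g z' \<le> dual_function W DD f g z}"

definition saddle_point ::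
  "('a::finite \<Rightarrow> 'u set) \<Rightarrow> 'v set \<Rightarrow> ('a \<Rightarrow> 'u \<Rightarrow> 'v \<Rightarrow> real) \<Rightarrow>
   ('a \<Rightarrow> 'u \<Rightarrow> 'v \<Rightarrow> real ^ 'm::finite) \<Rightarrow> ('a \<Rightarrow> 'u) \<Rightarrow> 'v \<Rightarrow> real ^ 'm \<Rightarrow> bool" where
  "saddle_point W DD f g ws Ds zs \<longleftrightarrow>
     (\<forall>i. ws i \<in> W i) \<and> Ds \<in> DD \<and> zs \<in> nonneg_orthant \<and>
     (\<forall>w D z. (\<forall>i. w i \<in> W i) \<and> D \<in> DD \<and> z \<in> nonneg_orthant \<longrightarrow>
        lagrangian f g ws Ds z \<le> lagrangian f g ws Ds zs \<and>
        lagrangian f g ws Ds zs \<le> lagrangian f g w D zs)"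

definition out_degree :: "real ^ 'a::finite ^ 'a \<Rightarrow> 'a \<Rightarrow> real" where
  "out_degree A i = (\<Sum>j\<in>UNIV. A $ i $ j)"

definition in_degree :: "real ^ 'a::finite ^ 'a \<Rightarrow> 'a \<Rightarrow> real" where
  "in_degree A i = (\<Sum>j\<in>UNIV. A $ j $ i)"

definition laplacian :: "real ^ 'a::finite ^ 'a \<Rightarrow> real ^ 'a ^ 'a" where
  "laplacian A = (\<chi> i j. if i = j then (A *v 1) $ i else 0) - A"

definition adjacency_matrix :: "real ^ 'a::finite ^ 'a \<Rightarrow> bool" where
  "adjacency_matrix A \<longleftrightarrow> (\<forall>i j. 0 \<le> A $ i $ j)"

definition edges :: "real ^ 'a::finite ^ 'a \<Rightarrow> ('a \<times> 'a) set" where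
  "edges A = {(i, j). 0 < A $ i $ j}"

definition weight_balanced :: "real ^ 'a::finite ^ 'a \<Rightarrow> bool" where
  "weight_balanced A \<longleftrightarrow> (\<forall>i. out_degree A i = in_degree A i)"

definition nondegenerate :: "real \<Rightarrow> (nat \<Rightarrow> real ^ 'a::finite ^ 'a) \<Rightarrow> bool" where
  "nondegenerate \<delta> A \<longleftrightarrow> (\<forall>t\<ge>1. \<forall>i j. 0 < A t $ i $ j \<longrightarrow> \<delta> < A t $ i $ j)"

definition strongly_connected_edges :: "('a \<times> 'a) set \<Rightarrow> bool" where
  "strongly_connected_edges E \<longleftrightarrow> (\<forall>i j. (i, j) \<in> E\<^sup>*)"

definition jointly_connected :: "nat \<Rightarrow> (nat \<Rightarrow> real ^ 'a::finite ^ 'a) \<Rightarrow> bool" where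
  "jointly_connected B A \<longleftrightarrow>
     (\<forall>k\<ge>1. strongly_connected_edges (\<Union>t\<in>{k * B..<(k + 1) * B}. edges (A t)))"

definition singular_values :: "real ^ 'n::finite ^ 'm::finite \<Rightarrow> real set" where
  "singular_values M =
     {s. 0 \<le> s \<and> (\<exists>v. v \<noteq> 0 \<and> (transpose M ** M) *v v = s\<^sup>2 *\<^sub>R v)}"

definition sigma_max :: "real ^ 'n::finite ^ 'm::finite \<Rightarrow> real" where
  "sigma_max M = Max (singular_values M)"

(* Time starts at t = 1; the values of all sequences at 0 are irrelevant.
   dfw, dfD, dgw, dgD are the subgradients selected by the agents. *)
definition c_sp_sg ::
  "('a::finite \<Rightarrow> 'k::finite set) \<Rightarrow> ('a \<Rightarrow> (real ^ 'k) set) \<Rightarrow> (real ^ 'd::finite) set \<Rightarrow>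
   ('a \<Rightarrow> real ^ 'k \<Rightarrow> real ^ 'd \<Rightarrow> real) \<Rightarrow> ('a \<Rightarrow> real ^ 'k \<Rightarrow> real ^ 'd \<Rightarrow> real ^ 'm::finite) \<Rightarrow>
   (nat \<Rightarrow> real ^ 'a ^ 'a) \<Rightarrow> real \<Rightarrow> (nat \<Rightarrow> real) \<Rightarrow> real \<Rightarrow>
   (nat \<Rightarrow> 'a \<Rightarrow> real ^ 'k) \<Rightarrow> (nat \<Rightarrow> 'a \<Rightarrow> real ^ 'd) \<Rightarrow>
   (nat \<Rightarrow> 'a \<Rightarrow> real ^ 'k ^ 'm) \<Rightarrow> (nat \<Rightarrow> 'a \<Rightarrow> real ^ 'd ^ 'm) \<Rightarrow>
   (nat \<Rightarrow> 'a \<Rightarrow> real ^ 'k) \<Rightarrow> (nat \<Rightarrow> 'a \<Rightarrow> real ^ 'd) \<Rightarrow> (nat \<Rightarrow> 'a \<Rightarrow> real ^ 'm) \<Rightarrow> bool" where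
  "c_sp_sg K W DD f g A \<sigma> \<eta> r dfw dfD dgw dgD w D z \<longleftrightarrow>
     (\<forall>i. w 1 i \<in> coord_space (K i) \<and> z 1 i \<in> nonneg_orthant) \<and>
     (\<forall>t\<ge>1. \<forall>i.
        dfw t i \<in> subdiff_fst (coord_space (K i)) (f i) (w t i) (D t i) \<and>
        dfD t i \<in> subdiff_snd (f i) (w t i) (D t i) \<and>
        (\<forall>l. row l (dgw t i) \<in>
               subdiff_fst (coord_space (K i)) (\<lambda>u v. g i u v $ l) (w t i) (D t i)) \<and>
        (\<forall>l. row l (dgD t i) \<in> subdiff_snd (\<lambda>u v. g i u v $ l) (w t i) (D t i)) \<and>
        w (t + 1) i = closest_point (W i)
          (w t i - \<eta> t *\<^sub>R (dfw t i + transpose (dgw t i) *v z t i)) \<and>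
        D (t + 1) i = closest_point DD
          (D t i + \<sigma> *\<^sub>R (\<Sum>j\<in>UNIV. A t $ i $ j *\<^sub>R (D t j - D t i))
             - \<eta> t *\<^sub>R (dfD t i + transpose (dgD t i) *v z t i)) \<and>
        z (t + 1) i = closest_point (nonneg_orthant \<inter> cball 0 r)
          (z t i + \<sigma> *\<^sub>R (\<Sum>j\<in>UNIV. A t $ i $ j *\<^sub>R (z t j - z t i))
             + \<eta> t *\<^sub>R g i (w t i) (D t i)))"

(* Meaningful for t \<ge> 2: time_avg x t is the average of x 1, ..., x (t - 1). *)
definition time_avg :: "(nat \<Rightarrow> 'a \<Rightarrow> 'v::real_vector) \<Rightarrow> nat \<Rightarrow> 'a \<Rightarrow> 'v" where
  "time_avg x t i = (1 / real (t - 1)) *\<^sub>R (\<Sum>s = 1..t - 1. x s i)"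

definition doubling_trick :: "(nat \<Rightarrow> real) \<Rightarrow> bool" where
  "doubling_trick \<eta> \<longleftrightarrow> (\<forall>p. \<forall>s\<in>{2 ^ p..2 ^ (p + 1) - 1}. \<eta> s = 1 / sqrt (2 ^ p))"

definition C_u :: "nat \<Rightarrow> real \<Rightarrow> nat \<Rightarrow> real" where
  "C_u N \<delta>t B = (2 ^ 5 / 3 ^ 2) / (1 - (1 - \<delta>t / (4 * real N ^ 2)) powr (1 / real B))"

(* The common shape of both constants: the indices 1 and 2 stand for (w, D) or for (\<mu>, z). *)
definition alpha_const :: "real \<Rightarrow> real \<Rightarrow> real \<Rightarrow> real \<Rightarrow> real \<Rightarrow> real \<Rightarrow> real \<Rightarrow> real" where
  "alpha_const \<sigma> \<Lambda> Cu B1 B2 H1 H2 =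
     sqrt 2 / (sqrt 2 - 1) *
       (4 * (B1\<^sup>2 + B2\<^sup>2) + 6 * (H1\<^sup>2 + H2\<^sup>2) + H2 * (3 + \<sigma> * \<Lambda>) * Cu * (B2 + 2 * H2))"

end

theory Submission
  imports Defs
begin

text \<open>
  Stacking the agents, one step of the algorithm for \<open>D\<close> (and likewise for \<open>z\<close>) is a projected
  subgradient step from the point \<open>(I - \<sigma> L\<^sub>t) D\<^sub>t\<close>, where \<open>I - \<sigma> L\<^sub>t\<close> is doubly stochastic. Since the
  projection does not move feasible points, the projected iterates follow the consensus dynamics up to
  a perturbation of norm at most \<open>\<eta>\<^sub>t H\<close>.

  Over a window of \<open>B\<close> steps the consensus dynamics contract the disagreement: sort the initial values
  and consider the cuts between consecutive values; at the first time a cut is crossed by an edge, the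
  energy drops in proportion to its squared gap. This gives the factor \<open>1 - \<delta>t / (4 N\<^sup>2)\<close> of \<open>C_u\<close>, and
  summing the perturbed recursion bounds the accumulated disagreement.

  The usual regret estimate for projected subgradient steps bounds the saddle-point gap of the averages
  against comparison points in agreement. Replacing the (non-agreeing) averages by their means costs
  twice the accumulated disagreement, and the mixing in the step costs twice more, because
  \<open>x - P x\<close> is at most twice the disagreement of \<open>x\<close>. These four units fit into
  \<open>3 + \<sigma> \<Lambda>\<close> because the numerical factors of \<open>\<alpha>\<close> leave room.
\<close>

text \<open>The saddle inequalities only concern points at which all agents share one
  \<open>D\<close> and one \<open>z\<close>, and the running averages are no such points. The upper
  bound repairs this for \<open>z\<close>, the lower bound for \<open>D\<close>. Both directions
  compare the iterates with a point that differs from them in \<open>w\<close> and \<open>D\<close>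
  at once. The partial subgradients of an agent must therefore combine into a subgradient of the
  pair, which convexity alone does not give for nonsmooth functions; hence
  \<open>joint_subgradients\<close>. The doubling trick is not analysed epoch by epoch:
  \<open>\<eta>\<close> is nonincreasing and lies between \<open>1 / sqrt s\<close> and
  \<open>sqrt 2 / sqrt s\<close>, so that one telescoping sum runs through all epochs. The factor
  \<open>sqrt 2 / (sqrt 2 - 1)\<close> of \<open>alpha_const\<close>, which an epochwise analysis
  obtains from a geometric series, enters as a number that is at least 3. The sorting argument
  controls the squared norm, with relative loss \<open>\<delta>t / (2 * N\<^sup>2)\<close> per
  window; passing to the norm halves this loss, whence the 4 in \<open>C_u\<close>.\<close>

subsection \<open>Stacked vectors and doubly stochastic averaging\<close>

text \<open>Both sides are the variance of \<open>x\<close> under the weights \<open>p\<close>. The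
  double sum has the merit of splitting into pairs of agents, each of which can be tested against a
  cut.\<close>

lemma variance_identity:
  fixes x :: "'a::finite \<Rightarrow> 'v::real_inner"
  assumes "(\<Sum>i\<in>UNIV. p i) = (1::real)"
  shows "(\<Sum>i\<in>UNIV. p i * (norm (x i))\<^sup>2) - (norm (\<Sum>i\<in>UNIV. p i *\<^sub>R x i))\<^sup>2
    = (\<Sum>i\<in>UNIV. \<Sum>j\<in>UNIV. p i * p j * (norm (x i - x j))\<^sup>2) / 2"
proof -
  let ?q = "\<Sum>i\<in>UNIV. p i * (norm (x i))\<^sup>2"
  let ?m = "\<Sum>i\<in>UNIV. p i *\<^sub>R x i"
  have "(\<Sum>i\<in>UNIV. \<Sum>j\<in>UNIV. p i * p j * (norm (x i - x j))\<^sup>2)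
      = (\<Sum>i\<in>UNIV. \<Sum>j\<in>UNIV. p j * (p i * (norm (x i))\<^sup>2) + p i * (p j * (norm (x j))\<^sup>2)
          - 2 * (p i *\<^sub>R x i \<bullet> p j *\<^sub>R x j))"
    by (intro sum.cong refl)
      (simp add: power2_norm_eq_inner inner_diff_left inner_diff_right inner_commute algebra_simps)
  also have "\<dots> = ?q + ?q - 2 * (\<Sum>i\<in>UNIV. \<Sum>j\<in>UNIV. p i *\<^sub>R x i \<bullet> p j *\<^sub>R x j)"
    by (simp only: sum.distrib sum_subtractf assms mult_1_left flip: sum_distrib_left sum_distrib_right)
  also have "(\<Sum>i\<in>UNIV. \<Sum>j\<in>UNIV. p i *\<^sub>R x i \<bullet> p j *\<^sub>R x j) = ?m \<bullet> ?m"
    by (subst inner_sum_left, subst inner_sum_right, rule refl)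
  finally show ?thesis
    by (simp add: power2_norm_eq_inner)
qed

definition doubly_stochastic :: "real ^ 'a::finite ^ 'a \<Rightarrow> bool" where
  "doubly_stochastic P \<longleftrightarrow>
     (\<forall>i j. 0 \<le> P $ i $ j) \<and> (\<forall>i. (\<Sum>j\<in>UNIV. P $ i $ j) = 1) \<and> (\<forall>j. (\<Sum>i\<in>UNIV. P $ i $ j) = 1)"

lemma doubly_stochasticD:
  assumes "doubly_stochastic P"
  shows "0 \<le> P $ i $ j" "(\<Sum>j\<in>UNIV. P $ i $ j) = 1" "(\<Sum>i\<in>UNIV. P $ i $ j) = 1"
  using assms by (auto simp: doubly_stochastic_def)

text \<open>The entries of \<open>x\<close> are themselves vectors, so \<open>*v\<close> does not
  apply; this is the Kronecker product of \<open>P\<close> with the identity, acting on stacked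
  states.\<close>

definition mix :: "real ^ 'a::finite ^ 'a \<Rightarrow> 'v::real_vector ^ 'a \<Rightarrow> 'v ^ 'a" where
  "mix P x = (\<chi> i. \<Sum>j\<in>UNIV. P $ i $ j *\<^sub>R x $ j)"

definition agreement :: "'v \<Rightarrow> 'v ^ 'a::finite" where
  "agreement c = (\<chi> i. c)"

definition mean :: "'v::real_vector ^ 'a::finite \<Rightarrow> 'v" where
  "mean x = (1 / real CARD('a)) *\<^sub>R (\<Sum>i\<in>UNIV. x $ i)"

text \<open>Subtracting the mean is the orthogonal projection along the agreeing stacks, so the norm
  of the result is the distance of \<open>x\<close> to agreement.\<close>

definition disagreement :: "'v::real_vector ^ 'a::finite \<Rightarrow> 'v ^ 'a" where
  "disagreement x = x - agreement (mean x)"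

lemma agreement_nth [simp]: "agreement c $ i = c"
  by (simp add: agreement_def)

lemma mix_nth: "mix P x $ i = (\<Sum>j\<in>UNIV. P $ i $ j *\<^sub>R x $ j)"
  by (simp add: mix_def)

lemma mix_diff: "mix P (x - y) = mix P x - mix P y"
  by (simp add: mix_def vec_eq_iff scaleR_diff_right sum_subtractf)

lemma mix_agreement:
  assumes "doubly_stochastic P"
  shows "mix P (agreement c) = agreement c"
  by (simp add: vec_eq_iff mix_nth doubly_stochasticD(2)[OF assms] flip: scaleR_left.sum)

lemma sum_mix:
  assumes "doubly_stochastic P"
  shows "(\<Sum>i\<in>UNIV. mix P x $ i) = (\<Sum>i\<in>UNIV. x $ i)"
proof -
  have "(\<Sum>i\<in>UNIV. mix P x $ i) = (\<Sum>j\<in>UNIV. \<Sum>i\<in>UNIV. P $ i $ j *\<^sub>R x $ j)"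
    unfolding mix_nth by (rule sum.swap)
  also have "\<dots> = (\<Sum>j\<in>UNIV. x $ j)"
    by (simp add: doubly_stochasticD(3)[OF assms] flip: scaleR_left.sum)
  finally show ?thesis .
qed

lemma power2_norm_vec: "(norm (x :: 'v::real_inner ^ 'a::finite))\<^sup>2 = (\<Sum>i\<in>UNIV. (norm (x $ i))\<^sup>2)"
  by (simp add: power2_norm_eq_inner inner_vec_def)

lemma norm_vec_le:
  fixes x :: "'v::real_inner ^ 'a::finite"
  assumes "\<And>i. norm (x $ i) \<le> b i"
  shows "norm x \<le> sqrt (\<Sum>i\<in>UNIV. (b i)\<^sup>2)"
proof (rule real_le_rsqrt)
  show "(norm x)\<^sup>2 \<le> (\<Sum>i\<in>UNIV. (b i)\<^sup>2)"
    unfolding power2_norm_vec by (intro sum_mono power_mono assms) auto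
qed

lemma norm_vec_mono:
  fixes x y :: "'v::real_inner ^ 'a::finite"
  assumes "\<And>i. norm (x $ i) \<le> norm (y $ i)"
  shows "norm x \<le> norm y"
  using assms by (simp add: norm_vec_def L2_set_mono)

text \<open>Row \<open>k\<close> has sum one, so the variance identity measures what agent
  \<open>k\<close> loses by averaging. When these losses are added up, the unit column sums
  reassemble the energy of \<open>x\<close>.\<close>

lemma mix_energy_loss:
  fixes x :: "'v::real_inner ^ 'a::finite"
  assumes "doubly_stochastic P"
  shows "(norm x)\<^sup>2 - (norm (mix P x))\<^sup>2
    = (\<Sum>k\<in>UNIV. \<Sum>i\<in>UNIV. \<Sum>j\<in>UNIV. P $ k $ i * P $ k $ j * (norm (x $ i - x $ j))\<^sup>2) / 2"
proof -
  have "(norm x)\<^sup>2 = (\<Sum>i\<in>UNIV. (\<Sum>k\<in>UNIV. P $ k $ i) * (norm (x $ i))\<^sup>2)"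
    by (simp add: power2_norm_vec doubly_stochasticD(3)[OF assms])
  also have "\<dots> = (\<Sum>k\<in>UNIV. \<Sum>i\<in>UNIV. P $ k $ i * (norm (x $ i))\<^sup>2)"
    unfolding sum_distrib_right by (rule sum.swap)
  finally have "(norm x)\<^sup>2 - (norm (mix P x))\<^sup>2 = (\<Sum>k\<in>UNIV. (\<Sum>i\<in>UNIV. P $ k $ i * (norm (x $ i))\<^sup>2)
      - (norm (\<Sum>i\<in>UNIV. P $ k $ i *\<^sub>R x $ i))\<^sup>2)"
    by (simp add: power2_norm_vec[of "mix P x"] mix_nth sum_subtractf)
  also have "\<dots> = (\<Sum>k\<in>UNIV. (\<Sum>i\<in>UNIV. \<Sum>j\<in>UNIV. P $ k $ i * P $ k $ j * (norm (x $ i - x $ j))\<^sup>2) / 2)"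
    by (intro sum.cong refl variance_identity doubly_stochasticD(2)[OF assms])
  finally show ?thesis
    by (simp add: sum_divide_distrib)
qed

lemma norm_mix_le:
  fixes x :: "'v::real_inner ^ 'a::finite"
  assumes "doubly_stochastic P"
  shows "norm (mix P x) \<le> norm x"
proof -
  have "0 \<le> (norm x)\<^sup>2 - (norm (mix P x))\<^sup>2"
    unfolding mix_energy_loss[OF assms]
    by (intro divide_nonneg_nonneg sum_nonneg mult_nonneg_nonneg doubly_stochasticD(1)[OF assms]) auto
  then show ?thesis
    by (simp add: norm_le_square power2_norm_eq_inner norm_eq_sqrt_inner)
qed

lemma sum_disagreement: "(\<Sum>i\<in>UNIV. disagreement (x :: 'v::real_vector ^ 'a::finite) $ i) = 0"
  by (simp add: disagreement_def mean_def sum_subtractf sum_constant_scaleR)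

lemma mean_mix: "doubly_stochastic P \<Longrightarrow> mean (mix P x) = mean x"
  by (simp add: mean_def sum_mix)

lemma mix_disagreement:
  "doubly_stochastic P \<Longrightarrow> mix P (disagreement x) = disagreement (mix P x)"
  by (simp add: disagreement_def mix_diff mix_agreement mean_mix)

lemma disagreement_add: "disagreement (x + y) = disagreement x + disagreement y"
  by (simp add: disagreement_def mean_def agreement_def vec_eq_iff sum.distrib scaleR_add_right)

lemma disagreement_scaleR: "disagreement (c *\<^sub>R x) = c *\<^sub>R disagreement x"
  by (simp add: disagreement_def mean_def agreement_def vec_eq_iff scaleR_diff_right
      flip: scaleR_sum_right)

lemma disagreement_sum: "disagreement (\<Sum>s\<in>S. x s) = (\<Sum>s\<in>S. disagreement (x s))"
proof (induction S rule: infinite_finite_induct)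
  case (insert s S)
  then show ?case by (simp add: disagreement_add)
qed (simp_all add: disagreement_def mean_def agreement_def vec_eq_iff)

lemma disagreement_inner_agreement:
  "disagreement (x :: 'v::real_inner ^ 'a::finite) \<bullet> agreement c = 0"
  by (simp add: inner_vec_def sum_disagreement flip: inner_sum_left)

lemma norm_disagreement_le:
  "norm (disagreement x) \<le> norm (x - agreement c :: 'v::real_inner ^ 'a::finite)"
proof -
  have "x - agreement c = disagreement x + agreement (mean x - c)"
    by (simp add: disagreement_def vec_eq_iff)
  moreover have "orthogonal (disagreement x) (agreement (mean x - c))"
    by (simp add: orthogonal_def disagreement_inner_agreement)
  ultimately have "(norm (x - agreement c))\<^sup>2 = (norm (disagreement x))\<^sup>2
      + (norm (agreement (mean x - c) :: 'v ^ 'a))\<^sup>2"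
    by (simp add: norm_add_Pythagorean)
  then have "(norm (disagreement x))\<^sup>2 \<le> (norm (x - agreement c))\<^sup>2"
    by simp
  then show ?thesis
    by (rule power2_le_imp_le) simp
qed

lemma norm_disagreement_le_norm:
  "norm (disagreement (x :: 'v::real_inner ^ 'a::finite)) \<le> norm x"
proof -
  have "agreement 0 = (0 :: 'v ^ 'a)"
    by (simp add: vec_eq_iff)
  then show ?thesis
    using norm_disagreement_le[of x 0] by simp
qed

lemma norm_diff_mix_le:
  fixes x :: "'v::real_inner ^ 'a::finite"
  assumes "doubly_stochastic P"
  shows "norm (x - mix P x) \<le> 2 * norm (disagreement x)"
proof -
  have "x - mix P x = disagreement x - mix P (disagreement x)"
    by (simp add: disagreement_def mix_diff mix_agreement[OF assms])
  also have "norm \<dots> \<le> norm (disagreement x) + norm (mix P (disagreement x))"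
    by (rule norm_triangle_ineq4)
  finally show ?thesis
    using norm_mix_le[OF assms, of "disagreement x"] by simp
qed

lemma norm_disagreement_average_le:
  fixes x :: "nat \<Rightarrow> 'v::real_inner ^ 'a::finite"
  assumes "T \<ge> 1"
  shows "real T * norm (disagreement ((1 / real T) *\<^sub>R (\<Sum>s=1..T. x s)))
      \<le> (\<Sum>s=1..T. norm (disagreement (x s)))"
  using assms by (simp add: disagreement_scaleR disagreement_sum norm_sum)

lemma mean_in_convex:
  fixes x :: "'v::real_vector ^ 'a::finite"
  assumes "convex C" "\<And>i. x $ i \<in> C"
  shows "mean x \<in> C"
  unfolding mean_def scaleR_sum_right using assms by (intro convex_sum) auto

lemma time_avg_in_convex:
  assumes "convex C" "\<And>s. s \<ge> 1 \<Longrightarrow> x s i \<in> C" "t \<ge> 2"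
  shows "time_avg x t i \<in> C"
  unfolding time_avg_def scaleR_sum_right using assms by (intro convex_sum) auto

subsection \<open>Contraction of the disagreement over a window\<close>

text \<open>The gaps are nonoverlapping intervals inside \<open>[a, b]\<close>, and squares of
  nonnegative lengths add up to at most the square of the total length. This is what allows several
  cuts to be crossed first at the same time.\<close>

lemma sum_squared_gaps_le:
  fixes v :: "nat \<Rightarrow> real"
  assumes "finite F" "mono_on {..n} v" "\<And>d. d \<in> F \<Longrightarrow> d < n"
    and "\<And>d. d \<in> F \<Longrightarrow> a \<le> v d" "\<And>d. d \<in> F \<Longrightarrow> v (Suc d) \<le> b" "a \<le> b"
  shows "(\<Sum>d\<in>F. (v (Suc d) - v d)\<^sup>2) \<le> (b - a)\<^sup>2"
  using assms
proof (induction F arbitrary: b rule: finite_linorder_max_induct)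
  case empty
  then show ?case by simp
next
  case (insert d F)
  have d: "d < n" "a \<le> v d" "v (Suc d) \<le> b"
    using insert.prems by auto
  have step: "v d \<le> v (Suc d)"
    using d by (intro mono_onD[OF insert.prems(1)]) auto
  have "(\<Sum>d\<in>F. (v (Suc d) - v d)\<^sup>2) \<le> (v d - a)\<^sup>2"
  proof (rule insert.IH)
    show "v (Suc c) \<le> v d" if "c \<in> F" for c
      using that d insert.hyps(2) by (intro mono_onD[OF insert.prems(1)]) auto
  qed (use insert.prems d in auto)
  moreover have "(v d - a)\<^sup>2 + (v (Suc d) - v d)\<^sup>2 \<le> (v (Suc d) - a)\<^sup>2"
    using mult_nonneg_nonneg[of "v d - a" "v (Suc d) - v d"] d step
    by (simp add: power2_eq_square algebra_simps)
  moreover have "(v (Suc d) - a)\<^sup>2 \<le> (b - a)\<^sup>2"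
    using d step by (intro power_mono) auto
  moreover have "d \<notin> F"
    using insert.hyps by blast
  ultimately show ?case
    using insert.hyps by simp
qed

text \<open>Repeated values are merged, so that every gap is positive and each cut between
  consecutive values has agents on both sides.\<close>

lemma sorted_values:
  fixes x :: "'a::finite \<Rightarrow> real"
  obtains n v where "n < CARD('a)" "strict_mono_on {..n} v" "range x = v ` {..n}"
proof -
  define vs where "vs = sorted_list_of_set (range x)"
  have set: "set vs = range x" and len: "length vs = card (range x)"
    and sorted: "sorted_wrt (<) vs"
    by (simp_all add: vs_def)
  have pos: "length vs > 0"
    unfolding len by (simp add: card_gt_0_iff)
  show thesis
  proof
    show "length vs - 1 < CARD('a)"
      using pos card_image_le[of UNIV x] len by simp
    show "strict_mono_on {..length vs - 1} ((!) vs)"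
      using pos sorted_wrt_nth_less[OF sorted] by (intro strict_mono_onI) auto
    have "{..length vs - 1} = {0..<length vs}"
      using pos by (cases vs) auto
    then show "range x = (!) vs ` {..length vs - 1}"
      using set nth_image[of "length vs" vs] by simp
  qed
qed

lemma edge_leaving:
  assumes "(i, j) \<in> E\<^sup>*" "i \<in> S" "j \<notin> S"
  obtains k l where "(k, l) \<in> E" "k \<in> S" "l \<notin> S"
  using assms by (induction rule: rtrancl_induct) auto

text \<open>The row sums \<open>C\<close> of \<open>P\<close> over \<open>S\<close> satisfy \<open>\<eta> \<le> C \<le> 1 - \<eta>\<close> for a node with an edge across
  the cut, and \<open>C (1 - C)\<close> is half of the corresponding inner double sum.\<close>
lemma cut_mixing_weight:
  fixes P :: "real ^ 'a::finite ^ 'a"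
  assumes P: "doubly_stochastic P" "\<And>i. \<eta> \<le> P $ i $ i" and \<eta>: "0 < \<eta>"
    and cross: "(k \<in> S) \<noteq> (l \<in> S)" "\<eta> \<le> P $ k $ l"
  shows "\<eta> \<le> (\<Sum>k\<in>UNIV. \<Sum>i\<in>UNIV. \<Sum>j\<in>UNIV. P $ k $ i * P $ k $ j * (if (i \<in> S) \<noteq> (j \<in> S) then 1 else 0))"
proof -
  define C where "C k = (\<Sum>i\<in>S. P $ k $ i)" for k
  have compl: "1 - C k = (\<Sum>i\<in>- S. P $ k $ i)" for k
    using sum.union_disjoint[of S "- S" "\<lambda>i. P $ k $ i"] doubly_stochasticD(2)[OF P(1), of k]
    by (simp add: C_def)
  have inner: "(\<Sum>i\<in>UNIV. \<Sum>j\<in>UNIV. P $ k $ i * P $ k $ j * (if (i \<in> S) \<noteq> (j \<in> S) then 1 else 0))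
      = 2 * (C k - (C k)\<^sup>2)" for k
  proof -
    let ?c = "\<lambda>i. if i \<in> S then 1 else 0 :: real"
    have "(\<Sum>i\<in>UNIV. \<Sum>j\<in>UNIV. P $ k $ i * P $ k $ j * (if (i \<in> S) \<noteq> (j \<in> S) then 1 else 0))
      = (\<Sum>i\<in>UNIV. \<Sum>j\<in>UNIV. P $ k $ i * P $ k $ j * (norm (?c i - ?c j))\<^sup>2)"
      by (intro sum.cong refl) auto
    also have "\<dots> = 2 * ((\<Sum>i\<in>UNIV. P $ k $ i * (norm (?c i))\<^sup>2)
        - (norm (\<Sum>i\<in>UNIV. P $ k $ i *\<^sub>R ?c i))\<^sup>2)"
      using variance_identity[OF doubly_stochasticD(2)[OF P(1)], of k ?c] by simp
    also have "(\<Sum>i\<in>UNIV. P $ k $ i * (norm (?c i))\<^sup>2) = C k"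
      unfolding C_def by (rule sum.mono_neutral_cong_right) auto
    also have "(\<Sum>i\<in>UNIV. P $ k $ i *\<^sub>R ?c i) = C k"
      unfolding C_def by (rule sum.mono_neutral_cong_right) auto
    finally show ?thesis by simp
  qed
  have C_range: "0 \<le> C k" "0 \<le> 1 - C k" for k
    unfolding compl using doubly_stochasticD(1)[OF P(1)] by (auto simp: C_def intro!: sum_nonneg)
  have member: "\<eta> \<le> (\<Sum>i\<in>T. P $ k $ i)" if "i \<in> T" "\<eta> \<le> P $ k $ i" for i T
    using that doubly_stochasticD(1)[OF P(1)] member_le_sum[of i T "\<lambda>i. P $ k $ i"] by force
  \<comment> \<open>The diagonal entry keeps weight \<eta> on the own side of \<open>k\<close>, the
    edge to \<open>l\<close> puts weight \<eta> on the other side. Expanding the product below gives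
    \<open>C k - (C k)\<^sup>2 \<ge> \<eta> - \<eta>\<^sup>2\<close>, and adding the two bounds
    gives \<open>2 * \<eta> \<le> 1\<close>.\<close>
  have C_k: "\<eta> \<le> C k" "\<eta> \<le> 1 - C k"
    unfolding compl using cross P(2)[of k] by (auto simp: C_def intro: member)
  then have "0 \<le> (C k - \<eta>) * (1 - \<eta> - C k)" "\<eta> * (2 * \<eta>) \<le> \<eta> * 1"
    using \<eta> by (auto intro!: mult_nonneg_nonneg mult_left_mono)
  then have "\<eta> \<le> 2 * (C k - (C k)\<^sup>2)"
    by (simp add: power2_eq_square algebra_simps)
  also have "\<dots> \<le> (\<Sum>k\<in>UNIV. 2 * (C k - (C k)\<^sup>2))"
  proof (rule member_le_sum)
    show "0 \<le> 2 * (C k - (C k)\<^sup>2)" for k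
      using mult_nonneg_nonneg[OF C_range, of k k] by (simp add: power2_eq_square algebra_simps)
  qed auto
  finally show ?thesis
    by (simp only: inner)
qed

text \<open>Until a cut is first crossed by an edge, its two sides stay separated by the initial gap; at the
  first crossing the energy drops by \<open>\<eta>/2\<close> times the squared gap, for all cuts simultaneously.\<close>
lemma mix_window_contraction_real:
  fixes P :: "nat \<Rightarrow> real ^ 'a::finite ^ 'a" and x :: "nat \<Rightarrow> real ^ 'a"
  assumes P: "\<And>s. s < n \<Longrightarrow> doubly_stochastic (P s)" "\<And>s i. s < n \<Longrightarrow> \<eta> \<le> P s $ i $ i"
    "\<And>s i j. s < n \<Longrightarrow> 0 < P s $ i $ j \<Longrightarrow> \<eta> \<le> P s $ i $ j"
    and \<eta>: "0 < \<eta>"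
    and connected: "strongly_connected_edges (\<Union>s<n. {(i, j). 0 < P s $ i $ j})"
    and x: "\<And>s. s < n \<Longrightarrow> x (Suc s) = mix (P s) (x s)" "(\<Sum>i\<in>UNIV. x 0 $ i) = 0"
  shows "(norm (x n))\<^sup>2 \<le> (1 - \<eta> / (2 * (real CARD('a))\<^sup>2)) * (norm (x 0))\<^sup>2"
proof -
  obtain m v where m: "m < CARD('a)" and v: "strict_mono_on {..m} v"
    and range: "range (\<lambda>i. x 0 $ i) = v ` {..m}"
    by (rule sorted_values)
  define S where "S d = {i. x 0 $ i \<le> v d}" for d
  \<comment> \<open>An edge in either direction counts. Before the first one, no agent gives weight
    to an agent on the other side, so each side is averaged within itself.\<close>
  define crossing where
    "crossing d s \<longleftrightarrow> s < n \<and> (\<exists>k l. (k \<in> S d) \<noteq> (l \<in> S d) \<and> 0 < P s $ k $ l)" for d s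
  define \<tau> where "\<tau> d = (LEAST s. crossing d s)" for d
  define gap where "gap d = v (Suc d) - v d" for d
  have mono: "mono_on {..m} v"
    using v by (rule strict_mono_on_imp_mono_on)
  have not_S: "v (Suc d) \<le> x 0 $ j" if "d < m" "j \<notin> S d" for d j
  proof -
    obtain e where e: "e \<le> m" "x 0 $ j = v e"
      using range by (metis (no_types, lifting) atMost_iff imageE rangeI)
    moreover have "\<not> e \<le> d"
      using that e mono_onD[OF mono, of e d] by (auto simp: S_def)
    ultimately show ?thesis
      using that mono_onD[OF mono, of "Suc d" e] by simp
  qed
  have crossing: "crossing d (\<tau> d)" if d: "d < m" for d
  proof -
    have "v d \<in> range (\<lambda>i. x 0 $ i)" "v (Suc d) \<in> range (\<lambda>i. x 0 $ i)"
      using d range by auto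
    then obtain i j where "v d = x 0 $ i" "v (Suc d) = x 0 $ j"
      by auto
    then have "i \<in> S d" "j \<notin> S d"
      using d strict_mono_onD[OF v, of d "Suc d"] by (auto simp: S_def)
    moreover have "(i, j) \<in> (\<Union>s<n. {(i, j). 0 < P s $ i $ j})\<^sup>*"
      using connected by (simp add: strongly_connected_edges_def)
    ultimately obtain k l where "(k, l) \<in> (\<Union>s<n. {(i, j). 0 < P s $ i $ j})" "k \<in> S d" "l \<notin> S d"
      by (meson edge_leaving)
    then have "\<exists>s. crossing d s"
      by (auto simp: crossing_def)
    then show ?thesis
      unfolding \<tau>_def by (rule LeastI_ex)
  qed
  have separated: "(i \<in> S d \<longrightarrow> x s $ i \<le> v d) \<and> (i \<notin> S d \<longrightarrow> v (Suc d) \<le> x s $ i)"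
    if "d < m" "s \<le> \<tau> d" for d s i
    using that(2)
  proof (induction s arbitrary: i)
    case 0
    then show ?case
      using not_S[OF that(1)] by (auto simp: S_def)
  next
    case (Suc s)
    have sn: "s < n"
      using Suc.prems crossing[OF that(1)] by (auto simp: crossing_def)
    have "\<not> crossing d s"
      using Suc.prems not_less_Least[of s "crossing d"] by (auto simp: \<tau>_def)
    then have same: "P s $ i $ j = 0" if "(i \<in> S d) \<noteq> (j \<in> S d)" for j
      using that sn doubly_stochasticD(1)[OF P(1)[OF sn], of i j] by (force simp: crossing_def)
    have IH: "j \<in> S d \<Longrightarrow> x s $ j \<le> v d" "j \<notin> S d \<Longrightarrow> v (Suc d) \<le> x s $ j" for j
      using Suc.IH Suc.prems by auto
    have row: "(\<Sum>j\<in>UNIV. P s $ i $ j * c) = c" for c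
      using doubly_stochasticD(2)[OF P(1)[OF sn], of i] by (simp flip: sum_distrib_right)
    have pos: "0 \<le> P s $ i $ j" for j
      by (rule doubly_stochasticD(1)[OF P(1)[OF sn]])
    have xi: "x (Suc s) $ i = (\<Sum>j\<in>UNIV. P s $ i $ j * x s $ j)"
      by (simp add: x(1)[OF sn] mix_nth)
    have "x (Suc s) $ i \<le> v d" if "i \<in> S d"
    proof -
      have "x (Suc s) $ i \<le> (\<Sum>j\<in>UNIV. P s $ i $ j * v d)"
        unfolding xi using that same pos IH(1)
        by (intro sum_mono) (metis mult_left_mono mult_zero_left order_refl)
      then show ?thesis by (simp add: row)
    qed
    moreover have "v (Suc d) \<le> x (Suc s) $ i" if "i \<notin> S d"
    proof -
      have "(\<Sum>j\<in>UNIV. P s $ i $ j * v (Suc d)) \<le> x (Suc s) $ i"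
        unfolding xi using that same pos IH(2)
        by (intro sum_mono) (metis mult_left_mono mult_zero_left order_refl)
      then show ?thesis by (simp add: row)
    qed
    ultimately show ?case by blast
  qed
  define sep where "sep d i j = (if (i \<in> S d) \<noteq> (j \<in> S d) then 1 else 0 :: real)" for d i j
  \<comment> \<open>The gaps of all cuts that separate \<open>i\<close> from \<open>j\<close> and
    are first crossed at time \<open>s\<close> still lie between the current values of
    \<open>i\<close> and \<open>j\<close>. Their squares can therefore be charged together to this
    one pair.\<close>
  have pair: "(\<Sum>d | d < m \<and> \<tau> d = s. (gap d)\<^sup>2 * sep d i j) \<le> (norm (x s $ i - x s $ j))\<^sup>2" for s i j
  proof -
    let ?F = "{d. d < m \<and> \<tau> d = s \<and> (i \<in> S d) \<noteq> (j \<in> S d)}"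
    have "(\<Sum>d | d < m \<and> \<tau> d = s. (gap d)\<^sup>2 * sep d i j) = (\<Sum>d\<in>?F. (v (Suc d) - v d)\<^sup>2)"
      by (rule sum.mono_neutral_cong_right) (auto simp: sep_def gap_def)
    also have "\<dots> \<le> (max (x s $ i) (x s $ j) - min (x s $ i) (x s $ j))\<^sup>2"
    proof (rule sum_squared_gaps_le[OF _ mono])
      fix d assume "d \<in> ?F"
      then show "min (x s $ i) (x s $ j) \<le> v d" "v (Suc d) \<le> max (x s $ i) (x s $ j)"
        using separated[of d s i] separated[of d s j] by auto
    qed auto
    also have "\<dots> = (norm (x s $ i - x s $ j))\<^sup>2"
      by (simp add: max_def min_def power2_commute)
    finally show ?thesis .
  qed
  have loss: "\<eta> / 2 * (\<Sum>d | d < m \<and> \<tau> d = s. (gap d)\<^sup>2) \<le> (norm (x s))\<^sup>2 - (norm (x (Suc s)))\<^sup>2"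
    if s: "s < n" for s
  proof -
    let ?D = "{d. d < m \<and> \<tau> d = s}"
    let ?w = "\<lambda>k i j. P s $ k $ i * P s $ k $ j"
    have "\<eta> * (\<Sum>d\<in>?D. (gap d)\<^sup>2) \<le> (\<Sum>d\<in>?D. (gap d)\<^sup>2 * (\<Sum>k\<in>UNIV. \<Sum>i\<in>UNIV. \<Sum>j\<in>UNIV. ?w k i j * sep d i j))"
      unfolding sum_distrib_left[of \<eta>]
    proof (rule sum_mono)
      fix d assume d: "d \<in> ?D"
      then obtain k l where kl: "(k \<in> S d) \<noteq> (l \<in> S d)" "0 < P s $ k $ l"
        using crossing[of d] by (auto simp: crossing_def)
      have "\<eta> \<le> (\<Sum>k\<in>UNIV. \<Sum>i\<in>UNIV. \<Sum>j\<in>UNIV. ?w k i j * sep d i j)"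
        unfolding sep_def by (rule cut_mixing_weight[OF P(1)[OF s] P(2)[OF s] \<eta> kl(1) P(3)[OF s kl(2)]])
      then show "\<eta> * (gap d)\<^sup>2 \<le> (gap d)\<^sup>2 * (\<Sum>k\<in>UNIV. \<Sum>i\<in>UNIV. \<Sum>j\<in>UNIV. ?w k i j * sep d i j)"
        by (subst mult.commute) (rule mult_left_mono, auto)
    qed
    \<comment> \<open>The sum over the cuts is moved inside the sums over the agents, where
      \<open>pair\<close> bounds it for each pair separately.\<close>
    also have "\<dots> = (\<Sum>d\<in>?D. \<Sum>k\<in>UNIV. \<Sum>i\<in>UNIV. \<Sum>j\<in>UNIV. ?w k i j * ((gap d)\<^sup>2 * sep d i j))"
      by (simp add: sum_distrib_left mult_ac)
    also have "\<dots> = (\<Sum>k\<in>UNIV. \<Sum>d\<in>?D. \<Sum>i\<in>UNIV. \<Sum>j\<in>UNIV. ?w k i j * ((gap d)\<^sup>2 * sep d i j))"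
      by (rule sum.swap)
    also have "\<dots> = (\<Sum>k\<in>UNIV. \<Sum>i\<in>UNIV. \<Sum>d\<in>?D. \<Sum>j\<in>UNIV. ?w k i j * ((gap d)\<^sup>2 * sep d i j))"
      by (rule sum.cong[OF refl], rule sum.swap)
    also have "\<dots> = (\<Sum>k\<in>UNIV. \<Sum>i\<in>UNIV. \<Sum>j\<in>UNIV. \<Sum>d\<in>?D. ?w k i j * ((gap d)\<^sup>2 * sep d i j))"
      by (intro sum.cong[OF refl], rule sum.swap)
    also have "\<dots> \<le> (\<Sum>k\<in>UNIV. \<Sum>i\<in>UNIV. \<Sum>j\<in>UNIV. ?w k i j * (norm (x s $ i - x s $ j))\<^sup>2)"
      unfolding sum_distrib_left[symmetric]
      by (intro sum_mono mult_left_mono pair mult_nonneg_nonneg doubly_stochasticD(1)[OF P(1)[OF s]])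
    also have "\<dots> = 2 * ((norm (x s))\<^sup>2 - (norm (x (Suc s)))\<^sup>2)"
      by (simp add: x(1)[OF s] mix_energy_loss[OF P(1)[OF s]])
    finally show ?thesis by simp
  qed
  have \<tau>: "\<tau> d < n" if "d < m" for d
    using crossing[OF that] by (simp add: crossing_def)
  have "\<eta> / 2 * (\<Sum>d<m. (gap d)\<^sup>2) = \<eta> / 2 * (\<Sum>s<n. \<Sum>d | d \<in> {..<m} \<and> \<tau> d = s. (gap d)\<^sup>2)"
    by (subst sum.group) (auto intro: \<tau>)
  also have "\<dots> = (\<Sum>s<n. \<eta> / 2 * (\<Sum>d | d < m \<and> \<tau> d = s. (gap d)\<^sup>2))"
    by (simp add: sum_distrib_left)
  also have "\<dots> \<le> (\<Sum>s<n. (norm (x s))\<^sup>2 - (norm (x (Suc s)))\<^sup>2)"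
    by (intro sum_mono loss) simp
  also have "\<dots> = (norm (x 0))\<^sup>2 - (norm (x n))\<^sup>2"
    by (rule sum_lessThan_telescope')
  finally have total: "\<eta> / 2 * (\<Sum>d<m. (gap d)\<^sup>2) \<le> (norm (x 0))\<^sup>2 - (norm (x n))\<^sup>2" .
  let ?N = "real CARD('a)"
  have bounds: "v 0 \<le> x 0 $ i" "x 0 $ i \<le> v m" for i
  proof -
    obtain e where e: "e \<le> m" "x 0 $ i = v e"
      using range by (metis (no_types, lifting) atMost_iff imageE rangeI)
    then show "v 0 \<le> x 0 $ i" "x 0 $ i \<le> v m"
      using mono_onD[OF mono, of 0 e] mono_onD[OF mono, of e m] by auto
  qed
  \<comment> \<open>Zero mean places 0 between the smallest and the largest value, so no entry
    exceeds the spread in absolute value.\<close>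
  have "?N * v 0 \<le> 0" "0 \<le> ?N * v m"
    using sum_mono[of UNIV "\<lambda>i. v 0" "\<lambda>i. x 0 $ i"] sum_mono[of UNIV "\<lambda>i. x 0 $ i" "\<lambda>i. v m"]
      bounds x(2) by auto
  then have "v 0 \<le> 0" "0 \<le> v m"
    by (auto simp: mult_le_0_iff zero_le_mult_iff)
  then have "norm (x 0 $ i) \<le> v m - v 0" for i
    using bounds[of i] by auto
  then have "(norm (x 0))\<^sup>2 \<le> (\<Sum>i\<in>(UNIV :: 'a set). (v m - v 0)\<^sup>2)"
    unfolding power2_norm_vec by (intro sum_mono power_mono) auto
  also have "\<dots> = ?N * (\<Sum>d<m. gap d)\<^sup>2"
    unfolding gap_def by (subst sum_lessThan_telescope) simp
  \<comment> \<open>One factor \<open>N\<close> counts the agents; the other comes from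
    Cauchy-Schwarz over the gaps, of which there are fewer than \<open>N\<close>.\<close>
  also have "\<dots> \<le> ?N * ((\<Sum>d<m. (gap d)\<^sup>2) * ?N)"
  proof (rule mult_left_mono)
    have "(\<Sum>d<m. gap d)\<^sup>2 \<le> (\<Sum>d<m. (gap d)\<^sup>2) * real m"
      using sum_squared_le_sum_of_squares[of gap "{..<m}"] by simp
    also have "\<dots> \<le> (\<Sum>d<m. (gap d)\<^sup>2) * ?N"
      using m by (intro mult_left_mono sum_nonneg) auto
    finally show "(\<Sum>d<m. gap d)\<^sup>2 \<le> (\<Sum>d<m. (gap d)\<^sup>2) * ?N" .
  qed simp
  finally have "(norm (x 0))\<^sup>2 \<le> ?N\<^sup>2 * (\<Sum>d<m. (gap d)\<^sup>2)"
    by (simp add: power2_eq_square algebra_simps)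
  then have "\<eta> / (2 * ?N\<^sup>2) * (norm (x 0))\<^sup>2 \<le> \<eta> / (2 * ?N\<^sup>2) * (?N\<^sup>2 * (\<Sum>d<m. (gap d)\<^sup>2))"
    using \<eta> by (intro mult_left_mono) auto
  also have "\<dots> = \<eta> / 2 * (\<Sum>d<m. (gap d)\<^sup>2)"
    by simp
  finally show ?thesis
    using total by (simp add: algebra_simps)
qed

text \<open>The bound \<open>3 / 4\<close>, attained for \<eta> = 1 and \<open>N = 1\<close>, is the
  source of the factors 4/3 and 5/4 in the comparison with \<open>C_u\<close>.\<close>

lemma contraction_rate_bounds:
  fixes N :: nat
  assumes "0 < \<eta>" "\<eta> \<le> 1" "0 < N"
  shows "3 / 4 \<le> 1 - \<eta> / (4 * (real N)\<^sup>2)" "1 - \<eta> / (4 * (real N)\<^sup>2) < 1"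
proof -
  have N: "(1::real) \<le> (real N)\<^sup>2"
    using assms(3) by (simp add: Suc_le_eq)
  then have "\<eta> \<le> (real N)\<^sup>2"
    using assms(2) by linarith
  then show "3 / 4 \<le> 1 - \<eta> / (4 * (real N)\<^sup>2)"
    using N by (auto simp: divide_le_eq_1)
  have "0 < \<eta> / (4 * (real N)\<^sup>2)"
    using assms by (intro divide_pos_pos) auto
  then show "1 - \<eta> / (4 * (real N)\<^sup>2) < 1"
    by simp
qed

text \<open>Sorting needs real values, so the scalar contraction is applied to each coordinate
  \<open>b\<close>, and the squared norms are added up. The root is taken through
  \<open>1 - 2 * \<epsilon> \<le> (1 - \<epsilon>)\<^sup>2\<close>.\<close>

lemma mix_window_contraction:
  fixes P :: "nat \<Rightarrow> real ^ 'a::finite ^ 'a" and x :: "nat \<Rightarrow> 'v::euclidean_space ^ 'a"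
  assumes P: "\<And>s. s < n \<Longrightarrow> doubly_stochastic (P s)" "\<And>s i. s < n \<Longrightarrow> \<eta> \<le> P s $ i $ i"
    "\<And>s i j. s < n \<Longrightarrow> 0 < P s $ i $ j \<Longrightarrow> \<eta> \<le> P s $ i $ j"
    and \<eta>: "0 < \<eta>" "\<eta> \<le> 1"
    and connected: "strongly_connected_edges (\<Union>s<n. {(i, j). 0 < P s $ i $ j})"
    and x: "\<And>s. s < n \<Longrightarrow> x (Suc s) = mix (P s) (x s)" "(\<Sum>i\<in>UNIV. x 0 $ i) = 0"
  shows "norm (x n) \<le> (1 - \<eta> / (4 * (real CARD('a))\<^sup>2)) * norm (x 0)"
proof -
  define \<epsilon> where "\<epsilon> = \<eta> / (4 * (real CARD('a))\<^sup>2)"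
  have "\<epsilon> \<le> 1"
    unfolding \<epsilon>_def
    using contraction_rate_bounds(1)[OF \<eta> zero_less_card_finite[where 'a = 'a]] by linarith
  define c where "c b s = (\<chi> i. x s $ i \<bullet> b)" for b s
  have norm_x: "(norm (x s))\<^sup>2 = (\<Sum>b\<in>Basis. (norm (c b s))\<^sup>2)" for s
  proof -
    have "(norm (x s))\<^sup>2 = (\<Sum>i\<in>UNIV. \<Sum>b\<in>Basis. (x s $ i \<bullet> b)\<^sup>2)"
      unfolding power2_norm_vec
      by (intro sum.cong refl) (subst power2_norm_eq_inner, subst euclidean_inner,
          simp add: power2_eq_square)
    also have "\<dots> = (\<Sum>b\<in>Basis. \<Sum>i\<in>UNIV. (x s $ i \<bullet> b)\<^sup>2)"
      by (rule sum.swap)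
    finally show ?thesis
      by (simp add: power2_norm_vec c_def)
  qed
  have "(norm (c b n))\<^sup>2 \<le> (1 - \<eta> / (2 * (real CARD('a))\<^sup>2)) * (norm (c b 0))\<^sup>2" for b
  proof (rule mix_window_contraction_real[OF P \<eta>(1) connected])
    show "c b (Suc s) = mix (P s) (c b s)" if "s < n" for s
      by (simp add: c_def vec_eq_iff x(1)[OF that] mix_nth inner_sum_left)
    show "(\<Sum>i\<in>UNIV. c b 0 $ i) = 0"
      using x(2) by (simp add: c_def flip: inner_sum_left)
  qed
  then have "(norm (x n))\<^sup>2 \<le> (1 - 2 * \<epsilon>) * (norm (x 0))\<^sup>2"
    unfolding norm_x sum_distrib_left by (intro sum_mono) (simp add: \<epsilon>_def)
  also have "\<dots> \<le> (1 - \<epsilon>)\<^sup>2 * (norm (x 0))\<^sup>2"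
    by (intro mult_right_mono) (auto simp: power2_eq_square algebra_simps)
  also have "\<dots> = ((1 - \<epsilon>) * norm (x 0))\<^sup>2"
    by (simp add: power_mult_distrib)
  finally have "norm (x n) \<le> (1 - \<epsilon>) * norm (x 0)"
    using \<open>\<epsilon> \<le> 1\<close> by (auto intro: power2_le_imp_le)
  then show ?thesis
    by (simp add: \<epsilon>_def)
qed

text \<open>The exact consensus trajectory \<open>y\<close>, started in the disagreement at time
  \<open>k\<close>, contracts over the window. The true disagreement drifts away from it by at most
  \<open>e s\<close> per step, because mixing does not enlarge norms.\<close>

lemma perturbed_window_contraction:
  fixes P :: "nat \<Rightarrow> real ^ 'a::finite ^ 'a" and x :: "nat \<Rightarrow> 'v::euclidean_space ^ 'a"
  assumes P: "\<And>s. s \<in> {k..<l} \<Longrightarrow> doubly_stochastic (P s)" "\<And>s i. s \<in> {k..<l} \<Longrightarrow> \<eta> \<le> P s $ i $ i"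
    "\<And>s i j. s \<in> {k..<l} \<Longrightarrow> 0 < P s $ i $ j \<Longrightarrow> \<eta> \<le> P s $ i $ j"
    and \<eta>: "0 < \<eta>" "\<eta> \<le> 1" and "k \<le> l"
    and connected: "strongly_connected_edges (\<Union>s\<in>{k..<l}. {(i, j). 0 < P s $ i $ j})"
    and x: "\<And>s. s \<in> {k..<l} \<Longrightarrow> norm (x (Suc s) - mix (P s) (x s)) \<le> e s"
  shows "norm (disagreement (x l))
    \<le> (1 - \<eta> / (4 * (real CARD('a))\<^sup>2)) * norm (disagreement (x k)) + (\<Sum>s\<in>{k..<l}. e s)"
proof -
  define n where "n = l - k"
  define y where "y = rec_nat (disagreement (x k)) (\<lambda>s. mix (P (k + s)))"
  have y: "y 0 = disagreement (x k)" "y (Suc s) = mix (P (k + s)) (y s)" for s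
    by (simp_all add: y_def)
  have "norm (disagreement (x (k + s)) - y s) \<le> (\<Sum>r\<in>{k..<k + s}. e r)" if "s \<le> n" for s
    using that
  proof (induction s)
    case (Suc s)
    then have s: "k + s \<in> {k..<l}"
      by (auto simp: n_def)
    let ?u = "x (Suc (k + s)) - mix (P (k + s)) (x (k + s))"
    have "disagreement (x (k + Suc s)) = disagreement (mix (P (k + s)) (x (k + s))) + disagreement ?u"
      by (simp flip: disagreement_add)
    then have "disagreement (x (k + Suc s)) - y (Suc s)
        = mix (P (k + s)) (disagreement (x (k + s)) - y s) + disagreement ?u"
      by (simp add: y mix_diff mix_disagreement[OF P(1)[OF s]])
    also have "norm \<dots> \<le> norm (disagreement (x (k + s)) - y s) + norm ?u"
      by (intro order_trans[OF norm_triangle_ineq] add_mono norm_mix_le[OF P(1)[OF s]]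
          norm_disagreement_le_norm)
    also have "\<dots> \<le> (\<Sum>r\<in>{k..<k + s}. e r) + e (k + s)"
      using Suc x[OF s] by (intro add_mono) auto
    finally show ?case
      by simp
  qed (simp add: y)
  from this[of n] have dev: "norm (disagreement (x l) - y n) \<le> (\<Sum>r\<in>{k..<l}. e r)"
    using \<open>k \<le> l\<close> by (simp add: n_def)
  have "{k..<l} = (\<lambda>s. k + s) ` {..<n}"
    using \<open>k \<le> l\<close> by (auto simp: n_def image_add_atLeastLessThan lessThan_atLeast0)
  then have "(\<Union>s<n. {(i, j). 0 < P (k + s) $ i $ j}) = (\<Union>s\<in>{k..<l}. {(i, j). 0 < P s $ i $ j})"
    by simp
  then have "norm (y n) \<le> (1 - \<eta> / (4 * (real CARD('a))\<^sup>2)) * norm (y 0)"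
    using connected
    by (intro mix_window_contraction[of n "\<lambda>s. P (k + s)"] P \<eta> y)
      (auto simp: n_def y sum_disagreement)
  then show ?thesis
    using dev norm_triangle_ineq2[of "disagreement (x l)" "y n"] by (simp add: y)
qed

text \<open>An amortized count with the potential \<open>B / (1 - \<rho>) * a (n * B)\<close>. A
  window costs at most \<open>B * a (n * B)\<close> plus \<open>B\<close> times its perturbations,
  and the contraction by \<rho> releases exactly \<open>B * a (n * B)\<close> of potential. The
  first window starts at time \<open>B\<close>; earlier times are covered in the base case by
  \<open>step\<close> alone.\<close>

lemma window_recursion_sum:
  fixes a e :: "nat \<Rightarrow> real"
  assumes B: "B \<ge> 1" and \<rho>: "0 \<le> \<rho>" "\<rho> < 1"
    and nonneg: "\<And>t. 0 \<le> a t" "\<And>t. 0 \<le> e t"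
    and step: "\<And>t. t \<ge> 1 \<Longrightarrow> a (Suc t) \<le> a t + e t"
    and window: "\<And>k. k \<ge> 1 \<Longrightarrow> a ((k + 1) * B) \<le> \<rho> * a (k * B) + (\<Sum>s\<in>{k * B..<(k + 1) * B}. e s)"
    and n: "n \<ge> 1"
  shows "(\<Sum>t\<in>{1..<n * B}. a t) + B / (1 - \<rho>) * a (n * B)
    \<le> (B + B / (1 - \<rho>)) * (a 1 + (\<Sum>s\<in>{1..<n * B}. e s))"
  using n
proof (induction n rule: dec_induct)
  have drift: "a t \<le> a t0 + (\<Sum>s\<in>{t0..<t1}. e s)" if "1 \<le> t0" "t0 \<le> t" "t \<le> t1" for t t0 t1
  proof -
    have "a t \<le> a t0 + (\<Sum>s\<in>{t0..<t}. e s)"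
      using that(2)
    proof (induction t rule: dec_induct)
      case (step t)
      then show ?case
        using assms(6)[of t] that by simp
    qed simp
    also have "\<dots> \<le> a t0 + (\<Sum>s\<in>{t0..<t1}. e s)"
      using that nonneg by (intro add_left_mono sum_mono2) auto
    finally show ?thesis .
  qed
  {
    case base
    let ?E = "a 1 + (\<Sum>s\<in>{1..<B}. e s)"
    have E: "0 \<le> ?E"
      using nonneg by (intro add_nonneg_nonneg sum_nonneg)
    have "(\<Sum>t\<in>{1..<B}. a t) \<le> (\<Sum>t\<in>{1..<B}. ?E)"
      by (intro sum_mono drift) auto
    also have "\<dots> \<le> B * ?E"
      using E by (auto intro!: mult_right_mono)
    finally have "(\<Sum>t\<in>{1..<B}. a t) \<le> B * ?E" .
    moreover have "B / (1 - \<rho>) * a B \<le> B / (1 - \<rho>) * ?E"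
      using B \<rho> by (intro mult_left_mono drift) auto
    ultimately show ?case
      by (simp add: distrib_right)
  next
    case (step n)
    let ?E = "\<Sum>s\<in>{n * B..<(n + 1) * B}. e s"
    have n: "1 \<le> n * B" "n * B \<le> (n + 1) * B"
      using step.hyps B by (auto simp: Suc_le_eq)
    have split: "(\<Sum>t\<in>{1..<(n + 1) * B}. h t) = (\<Sum>t\<in>{1..<n * B}. h t) + (\<Sum>t\<in>{n * B..<(n + 1) * B}. h t)"
      for h :: "nat \<Rightarrow> real"
      using n by (rule sum.atLeastLessThan_concat[symmetric])
    have "(\<Sum>t\<in>{n * B..<(n + 1) * B}. a t) \<le> (\<Sum>t\<in>{n * B..<(n + 1) * B}. a (n * B) + ?E)"
      using n by (intro sum_mono drift) auto
    then have "(\<Sum>t\<in>{n * B..<(n + 1) * B}. a t) \<le> B * (a (n * B) + ?E)"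
      by simp
    moreover have "B / (1 - \<rho>) * a ((n + 1) * B) \<le> B / (1 - \<rho>) * (\<rho> * a (n * B) + ?E)"
      using step.hyps \<rho> by (intro mult_left_mono window) auto
    moreover have "B * a (n * B) + B / (1 - \<rho>) * (\<rho> * a (n * B)) = B / (1 - \<rho>) * a (n * B)"
      using \<rho> by (simp add: divide_simps) (simp add: algebra_simps)
    ultimately have "(\<Sum>t\<in>{n * B..<(n + 1) * B}. a t) + B / (1 - \<rho>) * a ((n + 1) * B)
        \<le> B / (1 - \<rho>) * a (n * B) + (B + B / (1 - \<rho>)) * ?E"
      by (simp only: distrib_left distrib_right)
    then have "(\<Sum>t\<in>{1..<(n + 1) * B}. a t) + B / (1 - \<rho>) * a ((n + 1) * B)
      \<le> (B + B / (1 - \<rho>)) * (a 1 + (\<Sum>s\<in>{1..<(n + 1) * B}. e s))"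
      using step.IH unfolding split distrib_left by linarith
    then show ?case
      by simp
  }
qed

text \<open>\<open>T\<close> need not end a window, and perturbations after \<open>T\<close> must
  not enter. Setting both sequences to zero beyond \<open>T\<close> preserves the recursions, and
  after \<open>T + 1\<close> windows the potential has vanished.\<close>

lemma truncated_window_recursion_sum:
  fixes a e :: "nat \<Rightarrow> real"
  assumes B: "B \<ge> 1" and \<rho>: "0 \<le> \<rho>" "\<rho> < 1"
    and nonneg: "\<And>t. 0 \<le> a t" "\<And>t. 0 \<le> e t"
    and step: "\<And>t. t \<ge> 1 \<Longrightarrow> a (Suc t) \<le> a t + e t"
    and window: "\<And>k. k \<ge> 1 \<Longrightarrow> a ((k + 1) * B) \<le> \<rho> * a (k * B) + (\<Sum>s\<in>{k * B..<(k + 1) * B}. e s)"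
    and T: "T \<ge> 1"
  shows "(\<Sum>t=1..T. a t) \<le> (B + B / (1 - \<rho>)) * (a 1 + (\<Sum>s\<in>{1..<T}. e s))"
proof -
  define a' where "a' t = (if t \<le> T then a t else 0)" for t
  \<comment> \<open>The perturbation at time \<open>s\<close> acts on \<open>a (Suc s)\<close>, so
    the last one that matters is at \<open>T - 1\<close>.\<close>
  define e' where "e' t = (if t < T then e t else 0)" for t
  have "(T + 1) * 1 \<le> (T + 1) * B"
    using B by (intro mult_le_mono) auto
  then have T': "T < (T + 1) * B"
    by (simp del: add_mult_distrib)
  have "(\<Sum>t\<in>{1..<(T + 1) * B}. a' t) + B / (1 - \<rho>) * a' ((T + 1) * B)
    \<le> (B + B / (1 - \<rho>)) * (a' 1 + (\<Sum>s\<in>{1..<(T + 1) * B}. e' s))"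
  proof (rule window_recursion_sum[OF B \<rho>])
    show "0 \<le> a' t" "0 \<le> e' t" for t
      using nonneg by (auto simp: a'_def e'_def)
    show "a' (Suc t) \<le> a' t + e' t" if "t \<ge> 1" for t
      using step[OF that] nonneg by (auto simp: a'_def e'_def)
    show "a' ((k + 1) * B) \<le> \<rho> * a' (k * B) + (\<Sum>s\<in>{k * B..<(k + 1) * B}. e' s)" if "k \<ge> 1" for k
    proof (cases "(k + 1) * B \<le> T")
      case True
      then have "(\<Sum>s\<in>{k * B..<(k + 1) * B}. e' s) = (\<Sum>s\<in>{k * B..<(k + 1) * B}. e s)"
        by (intro sum.cong) (auto simp: e'_def)
      then show ?thesis
        using window[OF that] True by (auto simp: a'_def)
    next
      case False
      then show ?thesis
        using \<rho> nonneg
        by (auto simp: a'_def e'_def intro!: add_nonneg_nonneg mult_nonneg_nonneg sum_nonneg)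
    qed
  qed simp
  moreover have "(\<Sum>t\<in>{1..<(T + 1) * B}. a' t) = (\<Sum>t=1..T. a t)"
    using T' by (intro sum.mono_neutral_cong_right) (auto simp: a'_def)
  moreover have "(\<Sum>s\<in>{1..<(T + 1) * B}. e' s) = (\<Sum>s\<in>{1..<T}. e s)"
    using T' by (intro sum.mono_neutral_cong_right) (auto simp: e'_def)
  ultimately show ?thesis
    using T T' by (simp add: a'_def)
qed

text \<open>With \<open>y = \<rho> powr (1 / B)\<close>, the geometric sum
  \<open>1 - \<rho> = (1 - y) * (\<Sum>i<B. y ^ i)\<close> has \<open>B\<close> terms of size at
  least \<rho>, so \<open>B / (1 - \<rho>)\<close> is at most 4/3 times \<open>1 / (1 - y)\<close>.
  Since \<open>1 - \<rho> \<le> 1 / 4\<close>, the extra summand \<open>B\<close> costs a factor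
  5/4. The product 5/3 is below 16/9, half of the numerator of \<open>C_u\<close>.\<close>

lemma window_constant_le_C_u:
  fixes N B :: nat
  assumes \<delta>t: "0 < \<delta>t" "\<delta>t \<le> 1" and N: "0 < N" and B: "B \<ge> 1"
  defines "\<rho> \<equiv> 1 - \<delta>t / (4 * (real N)\<^sup>2)"
  shows "B + B / (1 - \<rho>) \<le> C_u N \<delta>t B / 2"
proof -
  have \<rho>: "3 / 4 \<le> \<rho>" "\<rho> < 1"
    unfolding \<rho>_def using \<delta>t N by (rule contraction_rate_bounds)+
  define y where "y = \<rho> powr (1 / B)"
  have "y ^ B = \<rho>"
    using \<rho> B by (simp add: y_def powr_powr flip: powr_realpow)
  have y: "0 < y" "y < 1"
    using \<rho> B powr_less_mono'[of \<rho> 0 "1 / B"] by (auto simp: y_def powr_less_one)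
  have "(\<Sum>i<B. \<rho>) \<le> (\<Sum>i<B. y ^ i)"
    unfolding \<open>y ^ B = \<rho>\<close>[symmetric] using y by (intro sum_mono power_decreasing) auto
  then have "(1 - y) * (B * \<rho>) \<le> (1 - y) * (\<Sum>i<B. y ^ i)"
    using y by (intro mult_left_mono) auto
  also have "\<dots> = 1 - \<rho>"
    using one_diff_power_eq[of y B] by (simp add: \<open>y ^ B = \<rho>\<close>)
  finally have "(1 - y) * (B * \<rho>) \<le> 1 - \<rho>" .
  moreover have "(1 - y) * (B * (3 / 4)) \<le> (1 - y) * (B * \<rho>)"
    using y \<rho> by (intro mult_left_mono) auto
  ultimately have "(1 - y) * B \<le> 4 / 3 * (1 - \<rho>)"
    by simp
  moreover have "B + B / (1 - \<rho>) \<le> 5 / 4 * (B / (1 - \<rho>))"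
  proof -
    have "real B * (4 * (1 - \<rho>)) \<le> real B * 1"
      using \<rho> by (intro mult_left_mono) auto
    then have "B \<le> 1 / 4 * (B / (1 - \<rho>))"
      using \<rho> by (simp add: pos_le_divide_eq algebra_simps)
    then show ?thesis
      by linarith
  qed
  ultimately have "(B + B / (1 - \<rho>)) * (1 - y) \<le> 5 / 4 * (B / (1 - \<rho>)) * (1 - y)"
    using y by (intro mult_right_mono) auto
  also have "\<dots> = 5 / 4 * ((1 - y) * B / (1 - \<rho>))"
    by simp
  also have "\<dots> \<le> 5 / 4 * (4 / 3)"
    using \<open>(1 - y) * B \<le> 4 / 3 * (1 - \<rho>)\<close> \<rho> by (intro mult_left_mono) (auto simp: pos_divide_le_eq)
  finally have "(B + B / (1 - \<rho>)) * (1 - y) \<le> 16 / 9"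
    by linarith
  then have "B + B / (1 - \<rho>) \<le> 16 / 9 / (1 - y)"
    using y by (subst pos_le_divide_eq) auto
  also have "(16 / 9 :: real) = 2 ^ 5 / 3 ^ 2 / 2"
    by simp
  finally show ?thesis
    by (simp only: C_u_def y_def \<rho>_def divide_divide_eq_left mult.commute)
qed

lemma C_u_nonneg:
  fixes N B :: nat
  assumes "0 < \<delta>t" "\<delta>t \<le> 1" "0 < N" "B \<ge> 1"
  shows "0 \<le> C_u N \<delta>t B"
proof -
  have "0 \<le> B + B / (1 - (1 - \<delta>t / (4 * (real N)\<^sup>2)))"
    using assms by simp
  then show ?thesis
    using window_constant_le_C_u[OF assms] by linarith
qed

lemma sum_disagreement_le:
  fixes P :: "nat \<Rightarrow> real ^ 'a::finite ^ 'a" and x :: "nat \<Rightarrow> 'v::euclidean_space ^ 'a"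
  assumes P: "\<And>s. s \<ge> 1 \<Longrightarrow> doubly_stochastic (P s)" "\<And>s i. s \<ge> 1 \<Longrightarrow> \<delta>t \<le> P s $ i $ i"
    "\<And>s i j. s \<ge> 1 \<Longrightarrow> 0 < P s $ i $ j \<Longrightarrow> \<delta>t \<le> P s $ i $ j"
    and \<delta>t: "0 < \<delta>t" "\<delta>t \<le> 1" and B: "B \<ge> 1"
    and connected: "\<And>k. k \<ge> 1 \<Longrightarrow>
      strongly_connected_edges (\<Union>s\<in>{k * B..<(k + 1) * B}. {(i, j). 0 < P s $ i $ j})"
    and x: "\<And>s. s \<ge> 1 \<Longrightarrow> norm (x (Suc s) - mix (P s) (x s)) \<le> e s" "\<And>s. 0 \<le> e s"
    and T: "T \<ge> 1"
  shows "(\<Sum>s=1..T. norm (disagreement (x s)))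
    \<le> C_u CARD('a) \<delta>t B / 2 * (norm (disagreement (x 1)) + (\<Sum>s\<in>{1..<T}. e s))"
proof -
  define \<rho> where "\<rho> = 1 - \<delta>t / (4 * (real CARD('a))\<^sup>2)"
  have \<rho>: "0 \<le> \<rho>" "\<rho> < 1"
    unfolding \<rho>_def
    using contraction_rate_bounds[OF \<delta>t zero_less_card_finite[where 'a = 'a]] by linarith+
  have "(\<Sum>s=1..T. norm (disagreement (x s)))
      \<le> (B + B / (1 - \<rho>)) * (norm (disagreement (x 1)) + (\<Sum>s\<in>{1..<T}. e s))"
  proof (rule truncated_window_recursion_sum[OF B \<rho> _ x(2)])
    fix s :: nat assume s: "s \<ge> 1"
    have "disagreement (x (Suc s))
        = mix (P s) (disagreement (x s)) + disagreement (x (Suc s) - mix (P s) (x s))"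
      by (simp add: mix_disagreement[OF P(1)[OF s]] flip: disagreement_add)
    also have "norm \<dots> \<le> norm (disagreement (x s)) + norm (x (Suc s) - mix (P s) (x s))"
      by (intro order_trans[OF norm_triangle_ineq] add_mono norm_mix_le[OF P(1)[OF s]]
          norm_disagreement_le_norm)
    finally show "norm (disagreement (x (Suc s))) \<le> norm (disagreement (x s)) + e s"
      using x(1)[OF s] by simp
  next
    fix k :: nat assume k: "k \<ge> 1"
    have ge: "s \<ge> 1" if "s \<in> {k * B..<(k + 1) * B}" for s
    proof -
      have "1 \<le> k * B"
        using k B by (simp add: Suc_le_eq)
      then show ?thesis
        using that unfolding atLeastLessThan_iff by linarith
    qed
    show "norm (disagreement (x ((k + 1) * B)))
        \<le> \<rho> * norm (disagreement (x (k * B))) + (\<Sum>s\<in>{k * B..<(k + 1) * B}. e s)"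
      unfolding \<rho>_def
      by (intro perturbed_window_contraction[where P = P] P ge \<delta>t connected[OF k] x(1)) auto
  qed (use T in auto)
  also have "\<dots> \<le> C_u CARD('a) \<delta>t B / 2 * (norm (disagreement (x 1)) + (\<Sum>s\<in>{1..<T}. e s))"
    unfolding \<rho>_def using \<delta>t B x(2)
    by (intro mult_right_mono window_constant_le_C_u add_nonneg_nonneg sum_nonneg)
        (auto simp: Suc_le_eq)
  finally show ?thesis .
qed

subsection \<open>Regret of projected subgradient steps\<close>

text \<open>The step departs from \<open>y\<close>, the mixed state, but the inequality is wanted at
  \<open>x\<close>. The squared distance passes from \<open>y\<close> to \<open>x\<close> because
  mixing does not increase the distance to \<open>p\<close>; moving the inner product from
  \<open>y\<close> to \<open>x\<close> costs \<open>H * norm (x - y)\<close>.\<close>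

lemma projected_step_inequality:
  fixes x y p q :: "'v::euclidean_space ^ 'a::finite"
  assumes C: "\<And>i. convex (C i)" "\<And>i. closed (C i)" "\<And>i. p $ i \<in> C i"
    and y: "norm (y - p) \<le> norm (x - p)" and \<eta>: "0 < \<eta>" and q: "norm q \<le> H"
    and x': "\<And>i. x' $ i = closest_point (C i) (y $ i - \<eta> *\<^sub>R q $ i)"
  shows "q \<bullet> (x - p) \<le> ((norm (x - p))\<^sup>2 - (norm (x' - p))\<^sup>2) / (2 * \<eta>) + \<eta> * H\<^sup>2 / 2 + H * norm (x - y)"
proof -
  have "norm (x' $ i - p $ i) \<le> norm ((y - \<eta> *\<^sub>R q - p) $ i)" for i
  proof -
    have "C i \<noteq> {}"
      using C(3)[of i] by auto
    then have "dist (x' $ i) (closest_point (C i) (p $ i)) \<le> dist (y $ i - \<eta> *\<^sub>R q $ i) (p $ i)"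
      unfolding x' by (intro closest_point_lipschitz C)
    then show ?thesis
      by (simp add: closest_point_self[OF C(3)] dist_norm)
  qed
  then have "norm (x' - p) \<le> norm (y - \<eta> *\<^sub>R q - p)"
    by (intro norm_vec_mono) simp
  then have "(norm (x' - p))\<^sup>2 \<le> (norm (y - \<eta> *\<^sub>R q - p))\<^sup>2"
    by (rule power_mono) simp
  also have "\<dots> = (norm (y - p))\<^sup>2 - 2 * \<eta> * (q \<bullet> (y - p)) + \<eta>\<^sup>2 * (norm q)\<^sup>2"
    by (simp only: power2_norm_eq_inner)
      (simp add: inner_diff_left inner_diff_right inner_commute power2_eq_square algebra_simps)
  also have "q \<bullet> (y - p) = q \<bullet> (x - p) - q \<bullet> (x - y)"
    by (simp add: inner_diff_right)
  finally have "2 * \<eta> * (q \<bullet> (x - p)) \<le> (norm (y - p))\<^sup>2 - (norm (x' - p))\<^sup>2 + \<eta>\<^sup>2 * (norm q)\<^sup>2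
      + 2 * \<eta> * (q \<bullet> (x - y))"
    by (simp add: algebra_simps)
  also have "\<dots> \<le> (norm (x - p))\<^sup>2 - (norm (x' - p))\<^sup>2 + \<eta>\<^sup>2 * H\<^sup>2 + 2 * \<eta> * (H * norm (x - y))"
  proof -
    have "q \<bullet> (x - y) \<le> norm q * norm (x - y)"
      by (rule norm_cauchy_schwarz)
    also have "\<dots> \<le> H * norm (x - y)"
      using q by (intro mult_right_mono) auto
    finally show ?thesis
      using y q \<eta> by (intro add_mono diff_mono mult_left_mono power_mono) auto
  qed
  finally have "q \<bullet> (x - p)
      \<le> ((norm (x - p))\<^sup>2 - (norm (x' - p))\<^sup>2 + \<eta>\<^sup>2 * H\<^sup>2 + 2 * \<eta> * (H * norm (x - y))) / (2 * \<eta>)"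
    using \<eta> by (simp add: pos_le_divide_eq mult_ac)
  also have "\<dots> = ((norm (x - p))\<^sup>2 - (norm (x' - p))\<^sup>2) / (2 * \<eta>) + \<eta> * H\<^sup>2 / 2 + H * norm (x - y)"
    using \<eta> by (simp add: add_divide_distrib diff_divide_distrib power2_eq_square)
  finally show ?thesis .
qed

text \<open>Summation by parts. The slack \<open>b - V (Suc T)\<close> is nonnegative, so it may be
  divided by the next, smaller stepsize before the next increment is added.\<close>

lemma weighted_telescope_le:
  fixes V \<eta> :: "nat \<Rightarrow> real"
  assumes \<eta>: "\<And>s. s \<ge> 1 \<Longrightarrow> 0 < \<eta> s" "\<And>s. s \<ge> 1 \<Longrightarrow> \<eta> (Suc s) \<le> \<eta> s"
    and V: "\<And>s. s \<ge> 1 \<Longrightarrow> V s \<le> b" and T: "T \<ge> 1"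
  shows "(\<Sum>s=1..T. (V s - V (Suc s)) / \<eta> s) \<le> (b - V (Suc T)) / \<eta> T"
  using T
proof (induction T rule: dec_induct)
  case base
  then show ?case
    using \<eta>(1)[of 1] V[of 1] by (simp add: divide_right_mono)
next
  case (step T)
  have "(b - V (Suc T)) / \<eta> T \<le> (b - V (Suc T)) / \<eta> (Suc T)"
    using step.hyps \<eta>(1)[of "Suc T"] \<eta>(1)[of T] \<eta>(2)[of T] V[of "Suc T"]
    by (intro divide_left_mono) auto
  then show ?case
    using step.IH by (simp add: diff_divide_distrib)
qed

lemma projected_regret:
  fixes x y q :: "nat \<Rightarrow> 'v::euclidean_space ^ 'a::finite"
  assumes C: "\<And>i. convex (C i)" "\<And>i. closed (C i)" "\<And>i. p $ i \<in> C i"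
    and y: "\<And>s. s \<ge> 1 \<Longrightarrow> norm (y s - p) \<le> norm (x s - p)"
    and \<eta>: "\<And>s. s \<ge> 1 \<Longrightarrow> 0 < \<eta> s" "\<And>s. s \<ge> 1 \<Longrightarrow> \<eta> (Suc s) \<le> \<eta> s"
    and q: "\<And>s. s \<ge> 1 \<Longrightarrow> norm (q s) \<le> H"
    and x: "\<And>s i. s \<ge> 1 \<Longrightarrow> x (Suc s) $ i = closest_point (C i) (y s $ i - \<eta> s *\<^sub>R q s $ i)"
      "\<And>s. s \<ge> 1 \<Longrightarrow> norm (x s - p) \<le> R"
    and T: "T \<ge> 1"
  shows "(\<Sum>s=1..T. q s \<bullet> (x s - p))
    \<le> R\<^sup>2 / (2 * \<eta> T) + H\<^sup>2 / 2 * (\<Sum>s=1..T. \<eta> s) + H * (\<Sum>s=1..T. norm (x s - y s))"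
proof -
  have "(\<Sum>s=1..T. q s \<bullet> (x s - p))
      \<le> (\<Sum>s=1..T. ((norm (x s - p))\<^sup>2 - (norm (x (Suc s) - p))\<^sup>2) / (2 * \<eta> s) + \<eta> s * H\<^sup>2 / 2
          + H * norm (x s - y s))"
    using y \<eta>(1) q x(1) by (intro sum_mono projected_step_inequality[where C = C] C) auto
  also have "\<dots> = (\<Sum>s=1..T. ((norm (x s - p))\<^sup>2 - (norm (x (Suc s) - p))\<^sup>2) / (2 * \<eta> s))
      + H\<^sup>2 / 2 * (\<Sum>s=1..T. \<eta> s) + H * (\<Sum>s=1..T. norm (x s - y s))"
    by (simp add: sum.distrib sum_distrib_left mult_ac)
  also have "(\<Sum>s=1..T. ((norm (x s - p))\<^sup>2 - (norm (x (Suc s) - p))\<^sup>2) / (2 * \<eta> s))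
      \<le> (R\<^sup>2 - (norm (x (Suc T) - p))\<^sup>2) / (2 * \<eta> T)"
    using \<eta> x(2) T
    by (intro weighted_telescope_le[of "\<lambda>s. 2 * \<eta> s" "\<lambda>s. (norm (x s - p))\<^sup>2"] power_mono) auto
  also have "\<dots> \<le> R\<^sup>2 / (2 * \<eta> T)"
    using \<eta>(1)[OF T] by (intro divide_right_mono) auto
  finally show ?thesis
    by simp
qed

lemma doubling_trick_exp:
  assumes "doubling_trick \<eta>" "s \<ge> 1"
  obtains p where "\<eta> s = 1 / sqrt (2 ^ p)" "2 ^ p \<le> s" "s < 2 ^ (p + 1)"
proof -
  obtain p where p: "2 ^ p \<le> s" "s < 2 ^ (p + 1)"
    using ex_power_ivl1[of 2 s] assms(2) by auto
  then have "s \<in> {2 ^ p..2 ^ (p + 1) - 1}"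
    by auto
  then show thesis
    using that p assms(1) unfolding doubling_trick_def by blast
qed

text \<open>Within an epoch the rate is frozen at its value \<open>1 / sqrt s\<close> for the first
  time \<open>s\<close> of the epoch, and the time less than doubles until the epoch ends.\<close>

lemma doubling_trick_bounds:
  assumes "doubling_trick \<eta>" "s \<ge> 1"
  shows "0 < \<eta> s" "1 / \<eta> s \<le> sqrt s" "\<eta> s \<le> sqrt 2 / sqrt s" "\<eta> (Suc s) \<le> \<eta> s"
proof -
  obtain p where p: "\<eta> s = 1 / sqrt (2 ^ p)" "2 ^ p \<le> s" "s < 2 ^ (p + 1)"
    using doubling_trick_exp[OF assms] .
  have "real (2 ^ p) \<le> real s" "real s \<le> real (2 ^ (p + 1))"
    using p by (simp_all only: of_nat_le_iff less_imp_le)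
  then have s: "2 ^ p \<le> real s" "real s \<le> 2 * 2 ^ p"
    by auto
  show "0 < \<eta> s"
    by (simp add: p)
  show "1 / \<eta> s \<le> sqrt s"
    using s by (simp add: p)
  have "sqrt s \<le> sqrt 2 * sqrt (2 ^ p)"
    using s by (simp flip: real_sqrt_mult)
  then show "\<eta> s \<le> sqrt 2 / sqrt s"
    using assms(2) by (simp add: p divide_simps)
  obtain p' where p': "\<eta> (Suc s) = 1 / sqrt (2 ^ p')" "2 ^ p' \<le> Suc s" "Suc s < 2 ^ (p' + 1)"
    using doubling_trick_exp[OF assms(1), of "Suc s"] by auto
  have "(2::nat) ^ p < 2 ^ (p' + 1)"
    using p p' by linarith
  then have "p \<le> p'"
    using power_less_imp_less_exp[of "2::nat" p "p' + 1"] by simp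
  then have "(2::real) ^ p \<le> 2 ^ p'"
    by (intro power_increasing) auto
  then show "\<eta> (Suc s) \<le> \<eta> s"
    by (simp add: p p' frac_le)
qed

lemma sum_inverse_sqrt_le: "(\<Sum>s=1..T. 1 / sqrt (real s)) \<le> 2 * sqrt T"
proof (induction T)
  case (Suc T)
  have "1 / sqrt (Suc T) \<le> 2 * (sqrt (Suc T) - sqrt T)"
  proof -
    have "1 = (sqrt (Suc T) - sqrt T) * (sqrt (Suc T) + sqrt T)"
      by (simp add: algebra_simps)
    also have "\<dots> \<le> (sqrt (Suc T) - sqrt T) * (2 * sqrt (Suc T))"
      by (intro mult_left_mono) auto
    finally show ?thesis
      by (simp add: divide_simps algebra_simps)
  qed
  then show ?case
    using Suc by simp
qed simp

lemma sum_doubling_trick_le: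
  assumes "doubling_trick \<eta>"
  shows "(\<Sum>s=1..T. \<eta> s) \<le> 2 * sqrt 2 * sqrt T"
proof -
  have "(\<Sum>s=1..T. \<eta> s) \<le> (\<Sum>s=1..T. sqrt 2 * (1 / sqrt s))"
    using doubling_trick_bounds(3)[OF assms] by (intro sum_mono) auto
  also have "\<dots> \<le> sqrt 2 * (2 * sqrt T)"
    unfolding sum_distrib_left[symmetric] by (intro mult_left_mono sum_inverse_sqrt_le) auto
  finally show ?thesis
    by simp
qed

lemma doubling_trick_regret:
  fixes x y q :: "nat \<Rightarrow> 'v::euclidean_space ^ 'a::finite"
  assumes C: "\<And>i. convex (C i)" "\<And>i. closed (C i)" "\<And>i. p $ i \<in> C i"
    and y: "\<And>s. s \<ge> 1 \<Longrightarrow> norm (y s - p) \<le> norm (x s - p)"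
    and \<eta>: "doubling_trick \<eta>"
    and q: "\<And>s. s \<ge> 1 \<Longrightarrow> norm (q s) \<le> H"
    and x: "\<And>s i. s \<ge> 1 \<Longrightarrow> x (Suc s) $ i = closest_point (C i) (y s $ i - \<eta> s *\<^sub>R q s $ i)"
      "\<And>s. s \<ge> 1 \<Longrightarrow> norm (x s - p) \<le> R"
    and T: "T \<ge> 1"
  shows "(\<Sum>s=1..T. q s \<bullet> (x s - p))
    \<le> sqrt T * (R\<^sup>2 / 2 + sqrt 2 * H\<^sup>2) + H * (\<Sum>s=1..T. norm (x s - y s))"
proof -
  note eta = doubling_trick_bounds[OF \<eta>]
  have "(\<Sum>s=1..T. q s \<bullet> (x s - p))
      \<le> R\<^sup>2 / (2 * \<eta> T) + H\<^sup>2 / 2 * (\<Sum>s=1..T. \<eta> s) + H * (\<Sum>s=1..T. norm (x s - y s))"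
    by (rule projected_regret[where C = C]) (use C y eta q x T in auto)
  also have "R\<^sup>2 / (2 * \<eta> T) = R\<^sup>2 / 2 * (1 / \<eta> T)"
    by simp
  also have "\<dots> \<le> R\<^sup>2 / 2 * sqrt T"
    using eta(2)[OF T] by (rule mult_left_mono) simp
  also have "H\<^sup>2 / 2 * (\<Sum>s=1..T. \<eta> s) \<le> H\<^sup>2 / 2 * (2 * sqrt 2 * sqrt T)"
    using sum_doubling_trick_le[OF \<eta>] by (rule mult_left_mono) simp
  finally show ?thesis
    by (simp add: algebra_simps)
qed

text \<open>The left side reserves \<open>2 * H\<close> times the accumulated disagreement for the
  later exchange of averages and means. Two more units come from \<open>x - P x\<close>, and the
  factor \<open>C_u / 2\<close> of the disagreement bound turns the four into
  \<open>2 * H * C_u\<close>. The radius \<open>R'\<close> is kept apart from \<open>R\<close> since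
  for \<open>z\<close> the initial disagreement is bounded by \<open>B_z\<close>, whereas distances
  to a comparison point are bounded by \<open>2 * B_z\<close>.\<close>

lemma consensus_regret:
  fixes P :: "nat \<Rightarrow> real ^ 'a::finite ^ 'a" and x q :: "nat \<Rightarrow> 'v::euclidean_space ^ 'a"
  assumes P: "\<And>s. s \<ge> 1 \<Longrightarrow> doubly_stochastic (P s)" "\<And>s i. s \<ge> 1 \<Longrightarrow> \<delta>t \<le> P s $ i $ i"
    "\<And>s i j. s \<ge> 1 \<Longrightarrow> 0 < P s $ i $ j \<Longrightarrow> \<delta>t \<le> P s $ i $ j"
    and \<delta>t: "0 < \<delta>t" "\<delta>t \<le> 1" and B: "B \<ge> 1"
    and connected: "\<And>k. k \<ge> 1 \<Longrightarrow>
      strongly_connected_edges (\<Union>s\<in>{k * B..<(k + 1) * B}. {(i, j). 0 < P s $ i $ j})"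
    and C: "convex C" "closed C" "p \<in> C"
    and \<eta>: "doubling_trick \<eta>"
    and q: "\<And>s. s \<ge> 1 \<Longrightarrow> norm (q s) \<le> H" "0 \<le> H"
    and x: "\<And>s i. s \<ge> 1 \<Longrightarrow> x s $ i \<in> C"
      "\<And>s i. s \<ge> 1 \<Longrightarrow> x (Suc s) $ i = closest_point C (mix (P s) (x s) $ i - \<eta> s *\<^sub>R q s $ i)"
      "\<And>s. s \<ge> 1 \<Longrightarrow> norm (x s - agreement p) \<le> R" "norm (disagreement (x 1)) \<le> R'"
    and T: "T \<ge> 1"
  shows "(\<Sum>s=1..T. q s \<bullet> (x s - agreement p)) + 2 * H * (\<Sum>s=1..T. norm (disagreement (x s)))
    \<le> sqrt T * (R\<^sup>2 / 2 + sqrt 2 * H\<^sup>2 + 2 * H * C_u CARD('a) \<delta>t B * (R' + 2 * sqrt 2 * H))"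
proof -
  note eta = doubling_trick_bounds[OF \<eta>]
  define Cu where "Cu = C_u CARD('a) \<delta>t B"
  have Cu: "0 \<le> Cu"
    unfolding Cu_def using \<delta>t zero_less_card_finite B by (rule C_u_nonneg)
  define dis where "dis = (\<Sum>s=1..T. norm (disagreement (x s)))"
  have sum_eta: "(\<Sum>s=1..T. \<eta> s) \<le> 2 * sqrt 2 * sqrt T"
    by (rule sum_doubling_trick_le[OF \<eta>])
  have step: "norm (x (Suc s) - mix (P s) (x s)) \<le> \<eta> s * H" if s: "s \<ge> 1" for s
  proof -
    have "norm ((x (Suc s) - mix (P s) (x s)) $ i) \<le> norm ((\<eta> s *\<^sub>R q s) $ i)" for i
    proof -
      have "mix (P s) (x s) $ i \<in> C"
        unfolding mix_nth using x(1)[OF s] doubly_stochasticD[OF P(1)[OF s]]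
        by (intro convex_sum C) auto
      then have "dist (x (Suc s) $ i) (mix (P s) (x s) $ i)
          \<le> dist (mix (P s) (x s) $ i - \<eta> s *\<^sub>R q s $ i) (mix (P s) (x s) $ i)"
        using closest_point_lipschitz[of C "mix (P s) (x s) $ i - \<eta> s *\<^sub>R q s $ i" "mix (P s) (x s) $ i"]
          C x(2)[OF s] by (auto simp: closest_point_self)
      then show ?thesis
        by (simp add: dist_norm)
    qed
    then have "norm (x (Suc s) - mix (P s) (x s)) \<le> norm (\<eta> s *\<^sub>R q s)"
      by (rule norm_vec_mono)
    also have "\<dots> \<le> \<eta> s * H"
      using eta(1)[OF s] q(1)[OF s] by simp
    finally show ?thesis .
  qed
  \<comment> \<open>\<open>\<eta> 0\<close> is arbitrary; the value 0 at time 0 makes the bound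
    nonnegative everywhere.\<close>
  define e where "e s = (if s \<ge> 1 then \<eta> s * H else 0)" for s
  have "dis \<le> Cu / 2 * (norm (disagreement (x 1)) + (\<Sum>s\<in>{1..<T}. e s))"
    unfolding dis_def Cu_def
    by (rule sum_disagreement_le[OF P \<delta>t B connected _ _ T])
      (use step eta(1) q(2) in \<open>auto simp: e_def less_imp_le\<close>)
  also have "\<dots> \<le> Cu / 2 * (sqrt T * (R' + 2 * sqrt 2 * H))"
  proof (rule mult_left_mono)
    have "(\<Sum>s\<in>{1..<T}. e s) = (\<Sum>s\<in>{1..<T}. \<eta> s * H)"
      by (intro sum.cong) (auto simp: e_def)
    also have "\<dots> \<le> (\<Sum>s=1..T. \<eta> s * H)"
      using eta(1) q(2) by (intro sum_mono2) (auto simp: less_imp_le)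
    also have "\<dots> \<le> 2 * sqrt 2 * sqrt T * H"
      unfolding sum_distrib_right[symmetric] using sum_eta q(2) by (rule mult_right_mono)
    finally have "(\<Sum>s\<in>{1..<T}. e s) \<le> 2 * sqrt 2 * sqrt T * H" .
    \<comment> \<open>The initial disagreement does not grow with \<open>T\<close>; it is absorbed
      through \<open>1 \<le> sqrt T\<close>.\<close>
    moreover have "norm (disagreement (x 1)) \<le> sqrt T * R'"
    proof -
      have "0 \<le> R'"
        using x(4) norm_ge_zero order_trans by blast
      then have "1 * R' \<le> sqrt T * R'"
        using T by (intro mult_right_mono) auto
      then show ?thesis
        using x(4) by simp
    qed
    ultimately show "norm (disagreement (x 1)) + (\<Sum>s\<in>{1..<T}. e s) \<le> sqrt T * (R' + 2 * sqrt 2 * H)"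
      by (simp add: algebra_simps)
  qed (use Cu in simp)
  finally have dis: "dis \<le> Cu / 2 * (sqrt T * (R' + 2 * sqrt 2 * H))" .
  have "(\<Sum>s=1..T. q s \<bullet> (x s - agreement p))
      \<le> sqrt T * (R\<^sup>2 / 2 + sqrt 2 * H\<^sup>2) + H * (\<Sum>s=1..T. norm (x s - mix (P s) (x s)))"
  proof (rule doubling_trick_regret[where C = "\<lambda>i. C", OF _ _ _ _ \<eta>])
    show "norm (mix (P s) (x s) - agreement p) \<le> norm (x s - agreement p)" if "s \<ge> 1" for s
      using norm_mix_le[OF P(1)[OF that], of "x s - agreement p"]
      by (simp add: mix_diff mix_agreement[OF P(1)[OF that]])
  qed (use C eta q x T in auto)
  also have "\<dots> \<le> sqrt T * (R\<^sup>2 / 2 + sqrt 2 * H\<^sup>2) + H * (2 * dis)"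
  proof (intro add_left_mono mult_left_mono q(2))
    show "(\<Sum>s=1..T. norm (x s - mix (P s) (x s))) \<le> 2 * dis"
      unfolding dis_def sum_distrib_left by (intro sum_mono norm_diff_mix_le P) simp
  qed
  finally have "(\<Sum>s=1..T. q s \<bullet> (x s - agreement p)) + 2 * H * dis
      \<le> sqrt T * (R\<^sup>2 / 2 + sqrt 2 * H\<^sup>2) + 4 * H * dis"
    by simp
  also have "4 * H * dis \<le> 4 * H * (Cu / 2 * (sqrt T * (R' + 2 * sqrt 2 * H)))"
    using dis q(2) by (intro mult_left_mono) auto
  finally show ?thesis
    by (simp add: dis_def Cu_def algebra_simps)
qed

text \<open>As \<open>sqrt 2 / (sqrt 2 - 1) \<ge> 3\<close>, half of \<open>alpha_const\<close> is
  at least 3/2 of its bracket, which contains \<open>3 * Y\<close> for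
  \<open>Y = H2 * Cu * (B2 + 2 * H2)\<close>. This affords \<open>9 / 2 * Y\<close>. The consensus
  term needs just that much: \<open>2 * sqrt 2 \<le> 3\<close>, and \<open>B2 + 3 * H2\<close> is at
  most 9/4 times \<open>B2 + 2 * H2\<close>. The 4 in the bound for \<open>R2\<close> is for the
  ball of radius \<open>r\<close>, whose diameter is \<open>2 * r\<close>.\<close>

lemma alpha_const_ge:
  fixes B1 B2 H1 H2 :: real
  assumes "0 \<le> B2" "0 \<le> H2" "0 \<le> Cu" "0 \<le> \<sigma>" "0 \<le> \<Lambda>" "R1\<^sup>2 \<le> B1\<^sup>2" "R2\<^sup>2 \<le> 4 * B2\<^sup>2"
  shows "R1\<^sup>2 / 2 + sqrt 2 * H1\<^sup>2 + (R2\<^sup>2 / 2 + sqrt 2 * H2\<^sup>2 + 2 * H2 * Cu * (B2 + 2 * sqrt 2 * H2))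
    \<le> alpha_const \<sigma> \<Lambda> Cu B1 B2 H1 H2 / 2"
proof -
  have sqrt2: "sqrt 2 \<le> 3 / 2" "1 < sqrt 2"
    by (rule real_le_lsqrt) (auto simp: power2_eq_square)
  then have c: "3 \<le> sqrt 2 / (sqrt 2 - 1)"
    by (simp add: pos_le_divide_eq)
  define Y where "Y = H2 * Cu * (B2 + 2 * H2)"
  define Q where "Q = H2 * (3 + \<sigma> * \<Lambda>) * Cu * (B2 + 2 * H2)"
  define Q' where "Q' = 2 * H2 * Cu * (B2 + 2 * sqrt 2 * H2)"
  define X where "X = 4 * (B1\<^sup>2 + B2\<^sup>2) + 6 * (H1\<^sup>2 + H2\<^sup>2) + Q"
  have "H2 * 3 * Cu * (B2 + 2 * H2) \<le> Q"
    unfolding Q_def using assms by (intro mult_right_mono mult_left_mono) auto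
  then have "3 * Y \<le> Q"
    by (simp add: Y_def mult_ac)
  moreover have "Q' \<le> 9 / 2 * Y"
  proof -
    have "sqrt 2 * H2 \<le> 3 / 2 * H2"
      using sqrt2 assms by (intro mult_right_mono) auto
    then have "B2 + 2 * sqrt 2 * H2 \<le> 9 / 4 * (B2 + 2 * H2)"
      using assms by simp
    then have "Q' \<le> 2 * H2 * Cu * (9 / 4 * (B2 + 2 * H2))"
      unfolding Q'_def using assms by (intro mult_left_mono) auto
    also have "\<dots> = 9 / 2 * Y"
      by (simp add: Y_def)
    finally show ?thesis .
  qed
  ultimately have "Q' \<le> 3 / 2 * Q"
    by linarith
  moreover have "R1\<^sup>2 / 2 \<le> 6 * B1\<^sup>2" "R2\<^sup>2 / 2 \<le> 6 * B2\<^sup>2"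
    using assms(6,7) zero_le_power2[of B1] zero_le_power2[of B2] by linarith+
  moreover have "sqrt 2 * H1\<^sup>2 \<le> 9 * H1\<^sup>2" "sqrt 2 * H2\<^sup>2 \<le> 9 * H2\<^sup>2"
    using sqrt2 by (intro mult_right_mono; simp)+
  ultimately have "R1\<^sup>2 / 2 + sqrt 2 * H1\<^sup>2 + (R2\<^sup>2 / 2 + sqrt 2 * H2\<^sup>2 + Q')
      \<le> 6 * B1\<^sup>2 + 9 * H1\<^sup>2 + (6 * B2\<^sup>2 + 9 * H2\<^sup>2 + 3 / 2 * Q)"
    by (intro add_mono)
  also have "\<dots> = 3 / 2 * X"
    by (simp add: X_def algebra_simps)
  also have "\<dots> \<le> sqrt 2 / (sqrt 2 - 1) / 2 * X"
  proof (rule mult_right_mono)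
    show "0 \<le> X"
      unfolding X_def Q_def using assms by (intro add_nonneg_nonneg mult_nonneg_nonneg) auto
    show "3 / 2 \<le> sqrt 2 / (sqrt 2 - 1) / 2"
      using c by (rule divide_right_mono) simp
  qed
  finally show ?thesis
    by (simp add: alpha_const_def X_def Q_def Q'_def)
qed

subsection \<open>The Laplacian mixing matrix\<close>

text \<open>The entries of the identity minus \<sigma> times \<open>laplacian A\<close>; a self-loop
  enters the degree and the diagonal entry with opposite signs.\<close>

definition consensus_matrix :: "real \<Rightarrow> real ^ 'a::finite ^ 'a \<Rightarrow> real ^ 'a ^ 'a" where
  "consensus_matrix \<sigma> A = (\<chi> i j. (if i = j then 1 - \<sigma> * out_degree A i else 0) + \<sigma> * A $ i $ j)"

lemma mix_consensus_matrix:
  "mix (consensus_matrix \<sigma> A) x $ i = x $ i + \<sigma> *\<^sub>R (\<Sum>j\<in>UNIV. A $ i $ j *\<^sub>R (x $ j - x $ i))"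
proof -
  have "mix (consensus_matrix \<sigma> A) x $ i
      = (\<Sum>j\<in>UNIV. (if i = j then (1 - \<sigma> * out_degree A i) *\<^sub>R x $ j else 0) + \<sigma> *\<^sub>R A $ i $ j *\<^sub>R x $ j)"
    unfolding mix_nth consensus_matrix_def by (intro sum.cong refl) (simp add: scaleR_add_left)
  also have "\<dots> = (1 - \<sigma> * out_degree A i) *\<^sub>R x $ i + \<sigma> *\<^sub>R (\<Sum>j\<in>UNIV. A $ i $ j *\<^sub>R x $ j)"
    by (simp add: sum.distrib scaleR_sum_right)
  also have "\<dots> = x $ i + \<sigma> *\<^sub>R ((\<Sum>j\<in>UNIV. A $ i $ j *\<^sub>R x $ j) - out_degree A i *\<^sub>R x $ i)"
    by (simp add: scaleR_diff_left scaleR_diff_right)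
  also have "out_degree A i *\<^sub>R x $ i = (\<Sum>j\<in>UNIV. A $ i $ j *\<^sub>R x $ i)"
    by (simp add: out_degree_def scaleR_left.sum)
  finally show ?thesis
    by (simp add: scaleR_diff_right sum_subtractf)
qed

text \<open>Row sums are one by construction; weight balance gives the column sums, and the degree
  bound keeps the diagonal nonnegative.\<close>

lemma doubly_stochastic_consensus_matrix:
  assumes A: "adjacency_matrix A" "weight_balanced A" and \<sigma>: "0 \<le> \<sigma>" "\<And>i. \<sigma> * out_degree A i \<le> 1"
  shows "doubly_stochastic (consensus_matrix \<sigma> A)"
  unfolding doubly_stochastic_def
proof (intro conjI allI)
  show "0 \<le> consensus_matrix \<sigma> A $ i $ j" for i j
    using A(1) \<sigma> by (simp add: consensus_matrix_def adjacency_matrix_def)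
  show "(\<Sum>j\<in>UNIV. consensus_matrix \<sigma> A $ i $ j) = 1" for i
    by (simp add: consensus_matrix_def sum.distrib out_degree_def flip: sum_distrib_left)
  show "(\<Sum>i\<in>UNIV. consensus_matrix \<sigma> A $ i $ j) = 1" for j
    using A(2) by (simp add: consensus_matrix_def sum.distrib weight_balanced_def in_degree_def
        flip: sum_distrib_left)
qed

text \<open>Finiteness gives the \<open>Max\<close> in \<open>sigma_max\<close> its meaning.
  Eigenvectors of the symmetric matrix \<open>transpose M ** M\<close> for distinct eigenvalues are
  orthogonal, hence independent, hence finite in number.\<close>

lemma finite_singular_values: "finite (singular_values (M :: real ^ 'n::finite ^ 'm::finite))"
proof -
  define S where "S = singular_values M"
  have "\<forall>s\<in>S. \<exists>v. v \<noteq> 0 \<and> (transpose M ** M) *v v = s\<^sup>2 *\<^sub>R v"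
    by (auto simp: S_def singular_values_def)
  then obtain v where v: "\<And>s. s \<in> S \<Longrightarrow> v s \<noteq> 0 \<and> (transpose M ** M) *v v s = s\<^sup>2 *\<^sub>R v s"
    by metis
  have orth: "v s \<bullet> v s' = 0" if "s \<in> S" "s' \<in> S" "s \<noteq> s'" for s s'
  proof -
    have "s\<^sup>2 * (v s \<bullet> v s') = ((transpose M ** M) *v v s) \<bullet> v s'"
      using v that by simp
    also have "\<dots> = v s \<bullet> ((transpose M ** M) *v v s')"
      by (metis dot_lmul_matrix matrix_transpose_mul transpose_matrix_vector transpose_transpose)
    also have "\<dots> = s'\<^sup>2 * (v s \<bullet> v s')"
      using v that by simp
    finally have "(s\<^sup>2 - s'\<^sup>2) * (v s \<bullet> v s') = 0"
      by (simp add: algebra_simps)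
    moreover have "s\<^sup>2 \<noteq> s'\<^sup>2"
      using that by (auto simp: S_def singular_values_def power2_eq_iff_nonneg)
    ultimately show ?thesis
      by simp
  qed
  have "inj_on v S"
  proof (rule inj_onI, rule ccontr)
    fix s s' assume "s \<in> S" "s' \<in> S" "v s = v s'" "s \<noteq> s'"
    then show False
      using orth[of s s'] v[of s'] by simp
  qed
  moreover have "independent (v ` S)"
    using orth v by (intro pairwise_orthogonal_independent) (auto simp: pairwise_def orthogonal_def)
  then have "finite (v ` S)"
    by (rule independent_imp_finite)
  ultimately show ?thesis
    using finite_imageD S_def by blast
qed

text \<open>The Laplacian annihilates the all-ones vector, so 0 is a singular value. This yields
  \<open>0 \<le> \<Lambda>\<close> in the theorem.\<close>

lemma sigma_max_laplacian_nonneg: "0 \<le> sigma_max (laplacian (A :: real ^ 'a::finite ^ 'a))"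
proof -
  have "laplacian A *v 1 = 0"
    by (simp add: laplacian_def matrix_vector_mult_diff_rdistrib)
      (simp add: vec_eq_iff matrix_vector_mult_def if_distrib[of "\<lambda>c. c * _"] cong: if_cong)
  then have "(transpose (laplacian A) ** laplacian A) *v 1 = 0\<^sup>2 *\<^sub>R (1 :: real ^ 'a)"
    by (simp flip: matrix_vector_mul_assoc)
  then have "0 \<in> singular_values (laplacian A)"
    unfolding singular_values_def by (auto intro!: exI[of _ 1])
  then show ?thesis
    unfolding sigma_max_def by (rule Max_ge[OF finite_singular_values])
qed

subsection \<open>Subgradients and boundedness of the agents' functions\<close>

lemma transpose_mult_vec:
  fixes M :: "real ^ 'n::finite ^ 'm::finite"
  shows "transpose M *v z = (\<Sum>l\<in>UNIV. z $ l *\<^sub>R row l M)"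
  by (simp add: vec_eq_iff matrix_vector_mult_def transpose_def row_def mult.commute)

text \<open>The factor \<open>sqrt (real CARD('m))\<close> compares the l1 norm of \<open>z\<close>
  with its Euclidean norm.\<close>

lemma norm_transpose_mult_vec_le:
  fixes M :: "real ^ 'n::finite ^ 'm::finite"
  assumes H: "\<And>l. norm (row l M) \<le> H" and z: "norm z \<le> r"
  shows "norm (transpose M *v z) \<le> r * sqrt (real CARD('m)) * H"
proof -
  have "0 \<le> H"
    using H norm_ge_zero order_trans by blast
  have "norm (transpose M *v z) \<le> (\<Sum>l\<in>UNIV. \<bar>z $ l\<bar> * H)"
    unfolding transpose_mult_vec
    by (intro order_trans[OF norm_sum] sum_mono) (simp add: H mult_left_mono)
  also have "\<dots> = (\<Sum>l\<in>UNIV. \<bar>z $ l\<bar>) * H"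
    by (simp add: sum_distrib_right)
  also have "(\<Sum>l\<in>UNIV. \<bar>z $ l\<bar>) \<le> sqrt ((\<Sum>l\<in>UNIV. \<bar>z $ l\<bar>\<^sup>2) * real CARD('m))"
    using sum_squared_le_sum_of_squares[of "\<lambda>l. \<bar>z $ l\<bar>" UNIV] by (intro real_le_rsqrt) simp
  also have "\<dots> = norm z * sqrt (real CARD('m))"
    by (simp add: norm_vec_def L2_set_def real_sqrt_mult)
  also have "\<dots> \<le> r * sqrt (real CARD('m))"
    using z by (intro mult_right_mono) auto
  finally show ?thesis
    using \<open>0 \<le> H\<close> by (simp add: mult_right_mono)
qed

lemma weighted_subgradient:
  fixes g :: "'v::real_inner \<Rightarrow> real ^ 'm::finite"
  assumes f: "f x + a \<bullet> (y - x) \<le> f y" and g: "\<And>l. g x $ l + b l \<bullet> (y - x) \<le> g y $ l"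
    and z: "z \<in> nonneg_orthant"
  shows "f x + z \<bullet> g x + (a + (\<Sum>l\<in>UNIV. z $ l *\<^sub>R b l)) \<bullet> (y - x) \<le> f y + z \<bullet> g y"
proof -
  have "z \<bullet> g x + (\<Sum>l\<in>UNIV. z $ l *\<^sub>R b l) \<bullet> (y - x) = (\<Sum>l\<in>UNIV. z $ l * (g x $ l + b l \<bullet> (y - x)))"
    by (simp add: inner_vec_def[of z] inner_sum_left sum.distrib distrib_left)
  also have "\<dots> \<le> z \<bullet> g y"
    unfolding inner_vec_def[of z] inner_real_def
    using g z by (intro sum_mono mult_left_mono) (auto simp: nonneg_orthant_def)
  finally show ?thesis
    using f by (simp add: inner_add_left)
qed

lemma agent_subgradient:
  fixes g :: "real ^ 'k::finite \<Rightarrow> real ^ 'd::finite \<Rightarrow> real ^ 'm::finite"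
  assumes f: "(a, b) \<in> subdiff_joint E f u v"
    and g: "\<And>l. (row l Ga, row l Gb) \<in> subdiff_joint E (\<lambda>u v. g u v $ l) u v"
    and z: "z \<in> nonneg_orthant" and u': "u' \<in> E"
  shows "f u v + z \<bullet> g u v + (a + transpose Ga *v z) \<bullet> (u' - u) + (b + transpose Gb *v z) \<bullet> (v' - v)
    \<le> f u' v' + z \<bullet> g u' v'"
proof -
  have "(case (u, v) of (u, v) \<Rightarrow> f u v) + z \<bullet> (case (u, v) of (u, v) \<Rightarrow> g u v)
      + ((a, b) + (\<Sum>l\<in>UNIV. z $ l *\<^sub>R (row l Ga, row l Gb))) \<bullet> ((u', v') - (u, v))
      \<le> (case (u', v') of (u, v) \<Rightarrow> f u v) + z \<bullet> (case (u', v') of (u, v) \<Rightarrow> g u v)"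
    using f g u' z
    by (intro weighted_subgradient) (auto simp: subdiff_joint_def subdifferential_def)
  then show ?thesis
    unfolding transpose_mult_vec
    by (simp add: prod_eq_iff inner_add_left fst_sum snd_sum inner_prod_def algebra_simps)
qed

lemma convex_on_weighted:
  fixes g :: "'v::real_vector \<Rightarrow> real ^ 'm::finite"
  assumes f: "convex_on S f" and g: "\<And>l. convex_on S (\<lambda>x. g x $ l)" and z: "z \<in> nonneg_orthant"
  shows "convex_on S (\<lambda>x. f x + z \<bullet> g x)"
proof (rule convex_on_add[OF f], unfold convex_on_def, intro conjI ballI allI impI)
  show "convex S"
    using f by (rule convex_on_imp_convex)
  fix x y and u v :: real assume *: "x \<in> S" "y \<in> S" "0 \<le> u" "0 \<le> v" "u + v = 1"
  then have "z \<bullet> g (u *\<^sub>R x + v *\<^sub>R y) \<le> (\<Sum>l\<in>UNIV. z $ l * (u * g x $ l + v * g y $ l))"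
    unfolding inner_vec_def[of z] inner_real_def
    using g z by (intro sum_mono mult_left_mono) (auto simp: nonneg_orthant_def convex_on_def)
  also have "\<dots> = u * (z \<bullet> g x) + v * (z \<bullet> g y)"
    by (simp add: inner_vec_def[of z] sum.distrib sum_distrib_left algebra_simps)
  finally show "z \<bullet> g (u *\<^sub>R x + v *\<^sub>R y) \<le> u * (z \<bullet> g x) + v * (z \<bullet> g y)" .
qed

text \<open>The graph point over \<open>x\<close> is separated from the strict epigraph by a
  hyperplane with normal \<open>(a, b)\<close>. If \<open>b\<close> were 0, moving from
  \<open>x\<close> along \<open>- a\<close> would contradict the separation, as \<open>h\<close> is
  finite everywhere. With \<open>b > 0\<close> the slope is \<open>- a\<close> divided by
  \<open>b\<close>; the \<open>e\<close> below passes from the strict epigraph to the graph.\<close>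

lemma convex_subgradient_exists:
  fixes h :: "'v::euclidean_space \<Rightarrow> real"
  assumes h: "convex_on UNIV h"
  obtains q where "\<And>y. h x + q \<bullet> (y - x) \<le> h y"
proof -
  let ?S = "{(y, t). h y < t}"
  have "convex ?S"
  proof (rule convexI, clarsimp)
    fix y1 t1 y2 t2 u v :: real
    fix y1 y2 :: 'v
    assume *: "h y1 < t1" "h y2 < t2" "0 \<le> u" "0 \<le> v" "u + v = 1"
    then have "h (u *\<^sub>R y1 + v *\<^sub>R y2) \<le> u * h y1 + v * h y2"
      using h by (auto simp: convex_on_def)
    also have "\<dots> < u * t1 + v * t2"
    proof (cases "u = 0")
      case False
      then have "u * h y1 < u * t1" "v * h y2 \<le> v * t2"
        using * by (auto intro: mult_left_mono)
      then show ?thesis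
        by linarith
    qed (use * in auto)
    finally show "h (u *\<^sub>R y1 + v *\<^sub>R y2) < u * t1 + v * t2" .
  qed
  moreover have "?S \<noteq> {}"
    using less_add_one[of "h x"] by blast
  ultimately obtain n c where n: "n \<noteq> 0" and c: "n \<bullet> (x, h x) \<le> c" "\<forall>p\<in>?S. c \<le> n \<bullet> p"
    using separating_hyperplane_sets[of "{(x, h x)}" ?S] by auto
  obtain a b where ab: "n = (a, b)"
    by (cases n)
  have sup: "a \<bullet> x + b * h x \<le> a \<bullet> y + b * t" if "h y < t" for y t
    using c that by (force simp: ab)
  have "b \<ge> 0"
    using sup[of x "h x + 1"] by (simp add: algebra_simps)
  moreover have "b \<noteq> 0"
  proof
    assume "b = 0"
    then have "a \<bullet> a \<le> 0"
      using sup[of "x - a" "h (x - a) + 1"] by (simp add: inner_diff_right)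
    then have "a = 0"
      by (metis inner_gt_zero_iff not_less)
    then show False
      using n ab \<open>b = 0\<close> by (simp add: zero_prod_def)
  qed
  ultimately have b: "b > 0"
    by simp
  have "h x + (- (1 / b) *\<^sub>R a) \<bullet> (y - x) \<le> h y" for y
  proof (rule field_le_epsilon)
    fix e :: real assume "0 < e"
    then have "a \<bullet> x + b * h x \<le> a \<bullet> y + b * (h y + e)"
      by (intro sup) simp
    then show "h x + (- (1 / b) *\<^sub>R a) \<bullet> (y - x) \<le> h y + e"
      using b by (simp add: inner_diff_right field_simps)
  qed
  then show thesis
    by (rule that)
qed

lemma convex_on_section:
  assumes "convex_on (E \<times> UNIV) (\<lambda>(u, v). h u v)" "u \<in> E"
  shows "convex_on UNIV (h u)"
  unfolding convex_on_def
proof (intro conjI ballI allI impI)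
  fix x y and a b :: real assume "0 \<le> a" "0 \<le> b" "a + b = 1"
  then have "(case a *\<^sub>R (u, x) + b *\<^sub>R (u, y) of (u, v) \<Rightarrow> h u v)
      \<le> a * (case (u, x) of (u, v) \<Rightarrow> h u v) + b * (case (u, y) of (u, v) \<Rightarrow> h u v)"
    using assms unfolding convex_on_def by blast
  then show "h u (a *\<^sub>R x + b *\<^sub>R y) \<le> a * h u x + b * h u y"
    using \<open>a + b = 1\<close> by (simp flip: scaleR_add_left)
qed simp

text \<open>The agents select subgradients only at their iterates, but the lower bound needs one at
  the mean of the averages. Bounding the whole subdifferential there controls whichever subgradient
  exists.\<close>

lemma agent_snd_subgradient_exists:
  fixes g :: "'u::real_vector \<Rightarrow> real ^ 'd::finite \<Rightarrow> real ^ 'm::finite"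
  assumes f: "convex_on (E \<times> UNIV) (\<lambda>(u, v). f u v)"
    and g: "\<And>l. convex_on (E \<times> UNIV) (\<lambda>(u, v). g u v $ l)" and u: "u \<in> E"
    and bound: "subdiff_snd f u v \<subseteq> cball 0 Hf" "\<And>l. subdiff_snd (\<lambda>u v. g u v $ l) u v \<subseteq> cball 0 Hg"
    and z: "z \<in> nonneg_orthant" "norm z \<le> r"
  obtains q where "norm q \<le> Hf + r * sqrt (real CARD('m)) * Hg"
    "\<And>v'. f u v + z \<bullet> g u v + q \<bullet> (v' - v) \<le> f u v' + z \<bullet> g u v'"
proof -
  obtain a where a: "\<And>v'. f u v + a \<bullet> (v' - v) \<le> f u v'"
    using convex_subgradient_exists[OF convex_on_section[OF f u], of v] by blast
  have "\<exists>b. \<forall>v'. g u v $ l + b \<bullet> (v' - v) \<le> g u v' $ l" for l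
    using convex_subgradient_exists[OF convex_on_section[OF g[of l] u], of v] by blast
  then obtain b where b: "\<And>l v'. g u v $ l + b l \<bullet> (v' - v) \<le> g u v' $ l"
    by metis
  define M :: "real ^ 'd ^ 'm" where "M = (\<chi> l. b l)"
  have row: "row l M = b l" for l
    by (simp add: M_def row_def vec_eq_iff)
  have "norm a \<le> Hf" "norm (row l M) \<le> Hg" for l
    using bound(1) bound(2)[of l] a b unfolding row
    by (force simp: subdiff_snd_def subdifferential_def)+
  then have "norm (a + transpose M *v z) \<le> Hf + r * sqrt (real CARD('m)) * Hg"
    using z(2) by (intro order_trans[OF norm_triangle_ineq] add_mono norm_transpose_mult_vec_le)
  moreover have "f u v + z \<bullet> g u v + (a + transpose M *v z) \<bullet> (v' - v) \<le> f u v' + z \<bullet> g u v'" for v'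
    unfolding transpose_mult_vec row using a b z(1) by (rule weighted_subgradient)
  ultimately show thesis
    by (rule that)
qed

text \<open>A box is the convex hull of finitely many points, and a convex function is bounded on a
  hull by its maximum over these points. As convexity is given on \<open>coord_space K\<close>, the
  box has width 0 in the coordinates outside \<open>K\<close>.\<close>

lemma convex_on_bdd_above_on_bounded:
  fixes h :: "(real ^ 'k::finite) \<times> (real ^ 'd::finite) \<Rightarrow> real"
  assumes h: "convex_on (coord_space K \<times> UNIV) h" and S: "bounded S" "S \<subseteq> coord_space K \<times> UNIV"
  shows "bdd_above (h ` S)"
proof -
  obtain a1 a2 where a: "S \<subseteq> cbox (- (a1, a2)) (a1, a2)"
    using bounded_subset_cbox_symmetric[OF S(1)] by (metis surj_pair)
  define c :: "real ^ 'k" where "c = (\<chi> j. if j \<in> K then a1 $ j else 0)"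
  let ?C = "cbox (- c, - a2) (c, a2)"
  have "S \<subseteq> ?C"
  proof
    fix p assume "p \<in> S"
    then show "p \<in> ?C"
      using a S(2) by (cases p) (force simp: cbox_Pair_eq mem_box_cart c_def coord_space_def)
  qed
  have C: "?C \<subseteq> coord_space K \<times> UNIV"
    by (force simp: cbox_Pair_eq mem_box_cart c_def coord_space_def intro: antisym split: if_splits)
  obtain V where V: "finite V" "?C = convex hull V"
    using closed_interval_as_convex_hull by blast
  have "convex_on (convex hull V) h"
    using C unfolding V(2) by (intro convex_on_subset[OF h] convex_convex_hull)
  moreover have "\<forall>x\<in>V. h x \<le> Max (insert 0 (h ` V))"
    using V(1) by simp
  ultimately have "\<forall>x\<in>convex hull V. h x \<le> Max (insert 0 (h ` V))"
    by (rule convex_on_convex_hull_bound)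
  then show ?thesis
    using \<open>S \<subseteq> ?C\<close> V(2) by (intro bdd_aboveI2) auto
qed

lemma subgradient_bdd_below_on_bounded:
  fixes h :: "'v::real_inner \<Rightarrow> real"
  assumes q: "q \<in> subdifferential E h x" and S: "bounded S" "S \<subseteq> E"
  shows "bdd_below (h ` S)"
proof -
  obtain c where c: "\<And>y. y \<in> S \<Longrightarrow> norm y \<le> c"
    using S(1) by (auto simp: bounded_iff)
  show ?thesis
  proof (rule bdd_belowI2)
    fix y assume y: "y \<in> S"
    have "- (q \<bullet> (y - x)) \<le> norm q * norm (y - x)"
      using norm_cauchy_schwarz[of "- q" "y - x"] by simp
    also have "\<dots> \<le> norm q * (c + norm x)"
      using c[OF y] norm_triangle_ineq4[of y x] by (intro mult_left_mono) auto
    finally show "h x - norm q * (c + norm x) \<le> h y"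
      using q S(2) y by (force simp: subdifferential_def)
  qed
qed

text \<open>This puts \<open>zs\<close> into the ball onto which the agents project, so that it is
  an admissible comparison point for \<open>z\<close>. The hypothesis \<open>bdd\<close> makes the
  real-valued \<open>Inf\<close> a genuine lower bound.\<close>

lemma saddle_point_optimal_dual:
  fixes W :: "'a::finite \<Rightarrow> 'u set"
  assumes saddle: "saddle_point W DD f g ws Ds zs"
    and bdd: "\<And>z. z \<in> nonneg_orthant \<Longrightarrow>
      bdd_below {lagrangian f g w D z | w D. (\<forall>i. w i \<in> W i) \<and> D \<in> DD}"
  shows "zs \<in> optimal_dual_set W DD f g"
proof -
  let ?L = "\<lambda>z. {lagrangian f g w D z | w D. (\<forall>i. w i \<in> W i) \<and> D \<in> DD}"
  have mem: "lagrangian f g ws Ds z \<in> ?L z" for z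
    using saddle by (auto simp: saddle_point_def)
  have "dual_function W DD f g z \<le> dual_function W DD f g zs" if z: "z \<in> nonneg_orthant" for z
  proof -
    have "dual_function W DD f g z \<le> lagrangian f g ws Ds z"
      unfolding dual_function_def by (intro cInf_lower mem bdd z)
    also have "\<dots> \<le> lagrangian f g ws Ds zs"
      using saddle z by (auto simp: saddle_point_def)
    also have "\<dots> \<le> dual_function W DD f g zs"
      unfolding dual_function_def using mem saddle
      by (intro cInf_greatest) (auto simp: saddle_point_def)
    finally show ?thesis .
  qed
  then show ?thesis
    using saddle by (auto simp: optimal_dual_set_def saddle_point_def)
qed

lemma closed_nonneg_orthant: "closed (nonneg_orthant :: (real ^ 'm::finite) set)"
  unfolding nonneg_orthant_def
  by (intro closed_Collect_all closed_Collect_le continuous_intros)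

lemma convex_nonneg_orthant: "convex (nonneg_orthant :: (real ^ 'm::finite) set)"
  by (auto simp: convex_def nonneg_orthant_def)

subsection \<open>The convergence rate\<close>

theorem corollaryV1:
  fixes K :: "'a::finite \<Rightarrow> 'k::finite set"
    and W :: "'a \<Rightarrow> (real ^ 'k) set"
    and DD :: "(real ^ 'd::finite) set"
    and f :: "'a \<Rightarrow> real ^ 'k \<Rightarrow> real ^ 'd \<Rightarrow> real"
    and g :: "'a \<Rightarrow> real ^ 'k \<Rightarrow> real ^ 'd \<Rightarrow> real ^ 'm::finite"
    and A :: "nat \<Rightarrow> real ^ 'a ^ 'a"
    and B :: nat
    and \<delta> \<delta>' \<delta>t \<Lambda> d_max \<sigma> r H_fw H_fD H_gw H_gD :: real
    and \<eta> :: "nat \<Rightarrow> real"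
    and dfw :: "nat \<Rightarrow> 'a \<Rightarrow> real ^ 'k" and dfD :: "nat \<Rightarrow> 'a \<Rightarrow> real ^ 'd"
    and dgw :: "nat \<Rightarrow> 'a \<Rightarrow> real ^ 'k ^ 'm" and dgD :: "nat \<Rightarrow> 'a \<Rightarrow> real ^ 'd ^ 'm"
    and w :: "nat \<Rightarrow> 'a \<Rightarrow> real ^ 'k" and D :: "nat \<Rightarrow> 'a \<Rightarrow> real ^ 'd"
    and z :: "nat \<Rightarrow> 'a \<Rightarrow> real ^ 'm"
    and ws :: "'a \<Rightarrow> real ^ 'k" and Ds :: "real ^ 'd" and zs :: "real ^ 'm"
    and N B_w B_D B_\<mu> B_z H_w H_D H_\<mu> H_z \<alpha>_wD \<alpha>_\<mu>z :: real
    and t :: nat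
  assumes W_sub: "\<And>i. W i \<subseteq> coord_space (K i)"
    and W_convex: "\<And>i. convex (W i)" and W_compact: "\<And>i. compact (W i)"
    and D_convex: "convex DD" and D_compact: "compact DD"
    and f_convex: "\<And>i. convex_on (coord_space (K i) \<times> UNIV) (\<lambda>(u, v). f i u v)"
    and g_convex: "\<And>i l. convex_on (coord_space (K i) \<times> UNIV) (\<lambda>(u, v). g i u v $ l)"
    and adjacency: "\<And>s. s \<ge> 1 \<Longrightarrow> adjacency_matrix (A s)"
    and B_pos: "B \<ge> 1" and connected: "jointly_connected B A"
    and \<delta>_pos: "\<delta> > 0" and nondeg: "nondegenerate \<delta> A"
    and balanced: "\<And>s. s \<ge> 1 \<Longrightarrow> weight_balanced (A s)"
    and \<Lambda>_bound: "\<And>s. s \<ge> 1 \<Longrightarrow> sigma_max (laplacian (A s)) \<le> \<Lambda>"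
    and degrees_bounded: "bdd_above {out_degree (A s) k | k s. s \<ge> 1}"
    and d_max: "d_max = Sup {out_degree (A s) k | k s. s \<ge> 1}"
    and \<delta>': "0 < \<delta>'" "\<delta>' < 1"
    and \<delta>t: "\<delta>t = min \<delta>' ((1 - \<delta>') * (\<delta> / d_max))"
    and \<sigma>_pos: "\<sigma> > 0" and \<sigma>_range: "\<sigma> \<in> {\<delta>t / \<delta> .. (1 - \<delta>t) / d_max}"
    and algorithm: "c_sp_sg K W DD f g A \<sigma> \<eta> r dfw dfD dgw dgD w D z"
    and learning_rates: "doubling_trick \<eta>"
    and init_feasible: "\<And>i. w 1 i \<in> W i" "\<And>i. D 1 i \<in> DD" "\<And>i. z 1 i \<in> cball 0 r"
    and joint_subgradients:
      "\<And>s i. s \<ge> 1 \<Longrightarrow>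
         (dfw s i, dfD s i) \<in> subdiff_joint (coord_space (K i)) (f i) (w s i) (D s i)"
      "\<And>s i l. s \<ge> 1 \<Longrightarrow>
         (row l (dgw s i), row l (dgD s i))
           \<in> subdiff_joint (coord_space (K i)) (\<lambda>u v. g i u v $ l) (w s i) (D s i)"
    and radius: "optimal_dual_set W DD f g \<subseteq> cball 0 r"
    and bound_fw: "\<And>i u v. u \<in> W i \<Longrightarrow> v \<in> DD \<Longrightarrow>
                     subdiff_fst (coord_space (K i)) (f i) u v \<subseteq> cball 0 H_fw"
    and bound_fD: "\<And>i u v. u \<in> W i \<Longrightarrow> v \<in> DD \<Longrightarrow> subdiff_snd (f i) u v \<subseteq> cball 0 H_fD"
    and bound_gw: "\<And>i l u v. u \<in> W i \<Longrightarrow> v \<in> DD \<Longrightarrow>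
                     subdiff_fst (coord_space (K i)) (\<lambda>u v. g i u v $ l) u v \<subseteq> cball 0 H_gw"
    and bound_gD: "\<And>i l u v. u \<in> W i \<Longrightarrow> v \<in> DD \<Longrightarrow>
                     subdiff_snd (\<lambda>u v. g i u v $ l) u v \<subseteq> cball 0 H_gD"
    and saddle: "saddle_point W DD f g ws Ds zs"
    and N: "N = real CARD('a)"
    and B_w: "B_w = sqrt (\<Sum>i\<in>UNIV. (diameter (W i))\<^sup>2)"
    and B_D: "B_D = sqrt N * diameter DD"
    and B_\<mu>: "B_\<mu> = 0"
    and B_z: "B_z = sqrt N * r"
    and H_w: "H_w = sqrt (N * (H_fw + r * sqrt (real CARD('m)) * H_gw)\<^sup>2)"
    and H_D: "H_D = sqrt (N * (H_fD + r * sqrt (real CARD('m)) * H_gD)\<^sup>2)"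
    and H_\<mu>: "H_\<mu> = 0"
    and H_z: "H_z = sqrt (\<Sum>i\<in>UNIV. (SUP (u, v)\<in>W i \<times> DD. norm (g i u v))\<^sup>2)"
    and \<alpha>_wD: "\<alpha>_wD = alpha_const \<sigma> \<Lambda> (C_u CARD('a) \<delta>t B) B_w B_D H_w H_D"
    and \<alpha>_\<mu>z: "\<alpha>_\<mu>z = alpha_const \<sigma> \<Lambda> (C_u CARD('a) \<delta>t B) B_\<mu> B_z H_\<mu> H_z"
    and t: "t \<ge> 2"
  shows "- (\<alpha>_\<mu>z + \<alpha>_wD) / (2 * sqrt (real (t - 1)))
           \<le> phi f g (time_avg w t) (time_avg D t) (time_avg z t) - lagrangian f g ws Ds zs
         \<and> phi f g (time_avg w t) (time_avg D t) (time_avg z t) - lagrangian f g ws Ds zs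
           \<le> (\<alpha>_wD + \<alpha>_\<mu>z) / (2 * sqrt (real (t - 1)))"
proof -
  define T where "T = t - 1"
  have T: "T \<ge> 1" "real T > 0"
    using t by (auto simp: T_def)
  define Zr where "Zr = nonneg_orthant \<inter> cball (0 :: real ^ 'm) r"
  have Zr: "convex Zr" "closed Zr"
    unfolding Zr_def
    by (intro convex_Int closed_Int convex_nonneg_orthant closed_nonneg_orthant
        convex_cball closed_cball)+
  have ws: "ws i \<in> W i" and Ds: "Ds \<in> DD" and zs_nonneg: "zs \<in> nonneg_orthant" for i
    using saddle by (auto simp: saddle_point_def)
  have W_closed: "closed (W i)" and D_closed: "closed DD"
    and W_bounded: "bounded (W i)" and D_bounded: "bounded DD" for i
    using W_compact D_compact by (auto simp: compact_imp_closed compact_imp_bounded)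
  have W_coord: "u \<in> coord_space (K i)" if "u \<in> W i" for u i
    using W_sub that by blast

  \<comment> \<open>Mixing matrices of the algorithm\<close>
  define P where "P s = consensus_matrix \<sigma> (A s)" for s
  have A_nonneg: "0 \<le> A s $ i $ j" if "s \<ge> 1" for s i j
    using adjacency[OF that] by (simp add: adjacency_matrix_def)
  have degree: "out_degree (A s) k \<le> d_max" if "s \<ge> 1" for s k
    unfolding d_max by (rule cSup_upper[OF _ degrees_bounded]) (use that in auto)
  \<comment> \<open>\<open>undefined\<close> is an arbitrary agent.\<close>
  have "0 \<le> out_degree (A 1) undefined"
    using A_nonneg[of 1] by (simp add: out_degree_def sum_nonneg)
  then have "0 \<le> d_max"
    using degree[of 1 undefined] by simp
  \<comment> \<open>Division by zero would make the upper end of the interval for \<sigma> equal to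
    0.\<close>
  moreover have "d_max \<noteq> 0"
    using \<sigma>_pos \<sigma>_range by auto
  ultimately have d_max_pos: "0 < d_max"
    by simp
  have \<delta>t_range: "0 < \<delta>t" "\<delta>t \<le> 1"
    using \<delta>' \<delta>_pos d_max_pos by (auto simp: \<delta>t)
  \<comment> \<open>The two ends of the interval for \<sigma>: the upper end keeps weight \<delta>t
    on the diagonal, the lower end keeps it on every edge.\<close>
  have \<sigma>_d_max: "\<sigma> * d_max \<le> 1 - \<delta>t" and \<sigma>_\<delta>: "\<delta>t \<le> \<sigma> * \<delta>"
    using \<sigma>_range d_max_pos \<delta>_pos by (auto simp: pos_le_divide_eq pos_divide_le_eq)
  have \<sigma>_degree: "\<sigma> * out_degree (A s) k \<le> 1 - \<delta>t" if "s \<ge> 1" for s k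
    using mult_left_mono[OF degree[OF that, of k], of \<sigma>] \<sigma>_pos \<sigma>_d_max by linarith
  have P_ds: "doubly_stochastic (P s)" if "s \<ge> 1" for s
    unfolding P_def
  proof (rule doubly_stochastic_consensus_matrix)
    show "\<sigma> * out_degree (A s) i \<le> 1" for i
      using \<sigma>_degree[OF that, of i] \<delta>t_range by linarith
  qed (use adjacency balanced that \<sigma>_pos in auto)
  have P_diag: "\<delta>t \<le> P s $ i $ i" if "s \<ge> 1" for s i
  proof -
    have "0 \<le> \<sigma> * A s $ i $ i"
      using A_nonneg[OF that] \<sigma>_pos by simp
    then show ?thesis
      using \<sigma>_degree[OF that, of i] by (simp add: P_def consensus_matrix_def)
  qed
  have P_edge: "\<delta>t \<le> P s $ i $ j" if s: "s \<ge> 1" and edge: "0 < A s $ i $ j" for s i j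
  proof (cases "i = j")
    case False
    have "\<delta> \<le> A s $ i $ j"
      using nondeg s edge by (auto simp: nondegenerate_def less_imp_le)
    then have "\<sigma> * \<delta> \<le> \<sigma> * A s $ i $ j"
      using \<sigma>_pos by (intro mult_left_mono) auto
    then show ?thesis
      using False \<sigma>_\<delta> by (simp add: P_def consensus_matrix_def)
  qed (use P_diag s in auto)
  have P_pos: "\<delta>t \<le> P s $ i $ j" if "s \<ge> 1" "0 < P s $ i $ j" for s i j
  proof (cases "i = j")
    case False
    then have "0 < A s $ i $ j"
      using that \<sigma>_pos by (simp add: P_def consensus_matrix_def zero_less_mult_iff)
    then show ?thesis
      by (rule P_edge[OF that(1)])
  qed (use P_diag that in auto)
  have P_connected: "strongly_connected_edges (\<Union>s\<in>{k * B..<(k + 1) * B}. {(i, j). 0 < P s $ i $ j})"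
    if "k \<ge> 1" for k
  proof -
    have "s \<ge> 1" if "s \<in> {k * B..<(k + 1) * B}" for s
    proof -
      have "1 \<le> k * B"
        using \<open>k \<ge> 1\<close> B_pos by (simp add: Suc_le_eq)
      then show ?thesis
        using that unfolding atLeastLessThan_iff by linarith
    qed
    then have "edges (A s) \<subseteq> {(i, j). 0 < P s $ i $ j}" if "s \<in> {k * B..<(k + 1) * B}" for s
      using P_edge[of s] \<delta>t_range(1) that by (force simp: edges_def)
    then have "(\<Union>s\<in>{k * B..<(k + 1) * B}. edges (A s))
        \<subseteq> (\<Union>s\<in>{k * B..<(k + 1) * B}. {(i, j). 0 < P s $ i $ j})"
      by blast
    then show ?thesis
      using connected that rtrancl_mono unfolding jointly_connected_def strongly_connected_edges_def
      by blast
  qed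
  have \<sigma>\<Lambda>: "0 \<le> \<sigma>" "0 \<le> \<Lambda>"
    using \<sigma>_pos sigma_max_laplacian_nonneg[of "A 1"] \<Lambda>_bound[of 1] by simp_all
  define Cu where "Cu = C_u CARD('a) \<delta>t B"
  have Cu: "0 \<le> Cu"
    unfolding Cu_def using \<delta>t_range zero_less_card_finite B_pos by (rule C_u_nonneg)

  \<comment> \<open>Stacked form of the iteration and feasibility of the iterates\<close>
  define X where "X s = (\<chi> i. D s i)" for s
  define Z where "Z s = (\<chi> i. z s i)" for s
  define Y where "Y s = (\<chi> i. w s i)" for s
  define qD where "qD s = (\<chi> i. dfD s i + transpose (dgD s i) *v z s i)" for s
  define qw where "qw s = (\<chi> i. dfw s i + transpose (dgw s i) *v z s i)" for s
  define G where "G u v = (\<chi> i. g i (u i) (v i))" for u v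
  note stack_defs = X_def Z_def Y_def qD_def qw_def G_def
  have selected: "dfw s i \<in> subdiff_fst (coord_space (K i)) (f i) (w s i) (D s i)"
    "dfD s i \<in> subdiff_snd (f i) (w s i) (D s i)"
    "row l (dgw s i) \<in> subdiff_fst (coord_space (K i)) (\<lambda>u v. g i u v $ l) (w s i) (D s i)"
    "row l (dgD s i) \<in> subdiff_snd (\<lambda>u v. g i u v $ l) (w s i) (D s i)"
    if "s \<ge> 1" for s i l
    using algorithm that unfolding c_sp_sg_def by blast+
  \<comment> \<open>The dual update is an ascent; written as a descent along \<open>- G\<close>, it
    falls under the same regret estimate as the primal blocks.\<close>
  have w_step: "Y (Suc s) $ i = closest_point (W i) (Y s $ i - \<eta> s *\<^sub>R qw s $ i)"
    and D_step: "X (Suc s) $ i = closest_point DD (mix (P s) (X s) $ i - \<eta> s *\<^sub>R qD s $ i)"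
    and z_step: "Z (Suc s) $ i = closest_point Zr (mix (P s) (Z s) $ i - \<eta> s *\<^sub>R (- G (w s) (D s)) $ i)"
    if "s \<ge> 1" for s i
    using algorithm that unfolding c_sp_sg_def
    by (simp_all add: stack_defs P_def mix_consensus_matrix Zr_def)
  have "z 1 i \<in> nonneg_orthant" for i
    using algorithm unfolding c_sp_sg_def by blast
  then have z_init: "z 1 i \<in> Zr" for i
    using init_feasible(3) by (simp add: Zr_def)
  then have Zr_ne: "Zr \<noteq> {}"
    by blast
  have feasible: "w s i \<in> W i \<and> D s i \<in> DD \<and> z s i \<in> Zr" if "s \<ge> 1" for s i
    using that
  proof (induction s rule: dec_induct)
    case base
    then show ?case
      using init_feasible z_init by simp
  next
    case (step s)
    have "Y (Suc s) $ i \<in> W i" "X (Suc s) $ i \<in> DD" "Z (Suc s) $ i \<in> Zr"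
      unfolding w_step[OF step.hyps(1)] D_step[OF step.hyps(1)] z_step[OF step.hyps(1)]
      using W_closed D_closed Zr Zr_ne ws[of i] Ds by (auto intro!: closest_point_in_set)
    then show ?case
      by (simp add: stack_defs)
  qed
  have r: "0 \<le> r"
    using Zr_ne by (auto simp: Zr_def intro: order_trans[OF norm_ge_zero])
  have z_nonneg: "z s i \<in> nonneg_orthant" and z_norm: "norm (z s i) \<le> r" if "s \<ge> 1" for s i
    using feasible[OF that, of i] by (auto simp: Zr_def)

  \<comment> \<open>Boundedness on the feasible sets and location of \<open>zs\<close>\<close>
  have S: "bounded (W i \<times> DD)" "W i \<times> DD \<subseteq> coord_space (K i) \<times> UNIV" for i
    using W_bounded D_bounded W_coord by (auto intro: bounded_Times)
  \<comment> \<open>The subgradients selected at time 1 are the slopes of affine minorants, which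
    are bounded below on bounded sets.\<close>
  have f_below: "bdd_below ((\<lambda>(u, v). f i u v) ` (W i \<times> DD))" for i
    using joint_subgradients(1)[of 1 i] S[of i] unfolding subdiff_joint_def
    by (intro subgradient_bdd_below_on_bounded) auto
  have g_below: "bdd_below ((\<lambda>(u, v). g i u v $ l) ` (W i \<times> DD))" for i l
    using joint_subgradients(2)[of 1 l i] S[of i] unfolding subdiff_joint_def
    by (intro subgradient_bdd_below_on_bounded) auto
  have g_above: "bdd_above ((\<lambda>(u, v). g i u v $ l) ` (W i \<times> DD))" for i l
    by (rule convex_on_bdd_above_on_bounded[OF g_convex S])
  have g_bdd: "bdd_above ((\<lambda>(u, v). norm (g i u v)) ` (W i \<times> DD))" for i
  proof -
    have "\<exists>c. \<forall>u\<in>W i. \<forall>v\<in>DD. \<bar>g i u v $ l\<bar> \<le> c" for l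
    proof -
      obtain a b where "\<And>u v. u \<in> W i \<Longrightarrow> v \<in> DD \<Longrightarrow> g i u v $ l \<le> a"
        "\<And>u v. u \<in> W i \<Longrightarrow> v \<in> DD \<Longrightarrow> b \<le> g i u v $ l"
        using g_above[of i l] g_below[of i l] unfolding bdd_above_def bdd_below_def by force
      then have "\<forall>u\<in>W i. \<forall>v\<in>DD. \<bar>g i u v $ l\<bar> \<le> max a (- b)"
        by (force simp: abs_le_iff le_max_iff_disj)
      then show ?thesis ..
    qed
    then obtain c where c: "\<And>l u v. u \<in> W i \<Longrightarrow> v \<in> DD \<Longrightarrow> \<bar>g i u v $ l\<bar> \<le> c l"
      by metis
    have "norm (g i u v) \<le> (\<Sum>l\<in>UNIV. c l)" if "u \<in> W i" "v \<in> DD" for u v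
      by (rule order_trans[OF norm_le_l1_cart sum_mono[OF c[OF that]]])
    then show ?thesis
      by (intro bdd_aboveI2) auto
  qed
  have "bdd_below {lagrangian f g u v y | u v. (\<forall>i. u i \<in> W i) \<and> v \<in> DD}"
    if y: "y \<in> nonneg_orthant" for y
  proof -
    have "\<exists>c. \<forall>u\<in>W i. \<forall>v\<in>DD. c \<le> f i u v" for i
      using f_below[of i] unfolding bdd_below_def by force
    then obtain a where a: "\<And>i u v. u \<in> W i \<Longrightarrow> v \<in> DD \<Longrightarrow> a i \<le> f i u v"
      by metis
    have "\<exists>c. \<forall>u\<in>W i. \<forall>v\<in>DD. c \<le> g i u v $ l" for i l
      using g_below[of i l] unfolding bdd_below_def by force
    then obtain b where b: "\<And>i l u v. u \<in> W i \<Longrightarrow> v \<in> DD \<Longrightarrow> b i l \<le> g i u v $ l"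
      by metis
    show ?thesis
    proof (rule bdd_belowI)
      fix L assume "L \<in> {lagrangian f g u v y | u v. (\<forall>i. u i \<in> W i) \<and> v \<in> DD}"
      then obtain u v where L: "L = lagrangian f g u v y" and uv: "\<And>i. u i \<in> W i" "v \<in> DD"
        by auto
      show "(\<Sum>i\<in>UNIV. a i + (\<Sum>l\<in>UNIV. y $ l * b i l)) \<le> L"
        unfolding L lagrangian_def inner_vec_def[of y] inner_real_def
        using uv y by (intro sum_mono add_mono mult_left_mono a b) (auto simp: nonneg_orthant_def)
    qed
  qed
  then have "zs \<in> optimal_dual_set W DD f g"
    by (rule saddle_point_optimal_dual[OF saddle])
  then have zs: "zs \<in> Zr"
    using radius zs_nonneg by (auto simp: Zr_def)

  \<comment> \<open>Norms of the search directions and distances to comparison points\<close>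
  define h_w where "h_w = H_fw + r * sqrt (real CARD('m)) * H_gw"
  define h_D where "h_D = H_fD + r * sqrt (real CARD('m)) * H_gD"
  have const_stack: "(\<Sum>i\<in>(UNIV :: 'a set). c) = N * c" for c
    by (simp add: N)
  have H_nonneg: "0 \<le> H_w" "0 \<le> H_D" "0 \<le> H_z"
    by (simp_all add: H_w H_D H_z N sum_nonneg)
  have qw_norm: "norm (qw s) \<le> H_w" and qD_norm: "norm (qD s) \<le> H_D" if s: "s \<ge> 1" for s
  proof -
    have feas: "w s i \<in> W i" "D s i \<in> DD" for i
      using feasible[OF s] by auto
    have "norm (qw s $ i) \<le> h_w" for i
    proof -
      have "norm (dfw s i) \<le> H_fw" "\<And>l. norm (row l (dgw s i)) \<le> H_gw"
        using subsetD[OF bound_fw[OF feas] selected(1)[OF s]]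
          subsetD[OF bound_gw[OF feas] selected(3)[OF s]] by simp_all
      then show ?thesis
        unfolding h_w_def qw_def vec_lambda_beta using z_norm[OF s]
        by (intro order_trans[OF norm_triangle_ineq] add_mono norm_transpose_mult_vec_le)
    qed
    then show "norm (qw s) \<le> H_w"
      using norm_vec_le[of "qw s" "\<lambda>i. h_w"] by (simp only: const_stack H_w h_w_def)
    have "norm (qD s $ i) \<le> h_D" for i
    proof -
      have "norm (dfD s i) \<le> H_fD" "\<And>l. norm (row l (dgD s i)) \<le> H_gD"
        using subsetD[OF bound_fD[OF feas] selected(2)[OF s]]
          subsetD[OF bound_gD[OF feas] selected(4)[OF s]] by simp_all
      then show ?thesis
        unfolding h_D_def qD_def vec_lambda_beta using z_norm[OF s]
        by (intro order_trans[OF norm_triangle_ineq] add_mono norm_transpose_mult_vec_le)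
    qed
    then show "norm (qD s) \<le> H_D"
      using norm_vec_le[of "qD s" "\<lambda>i. h_D"] by (simp only: const_stack H_D h_D_def)
  qed
  have G_norm: "norm (G u v) \<le> H_z" if "\<And>i. u i \<in> W i" "\<And>i. v i \<in> DD" for u v
    unfolding H_z
  proof (rule norm_vec_le)
    show "norm (G u v $ i) \<le> (SUP (u, v)\<in>W i \<times> DD. norm (g i u v))" for i
      using cSUP_upper[OF _ g_bdd[of i], of "(u i, v i)"] that by (simp add: G_def)
  qed

  have dist_w: "norm (Y s - (\<chi> i. u i)) \<le> B_w" if "s \<ge> 1" "\<And>i. u i \<in> W i" for s u
    unfolding B_w using diameter_bounded_bound[OF W_bounded] feasible[OF that(1)] that(2)
    by (intro norm_vec_le) (auto simp: Y_def dist_norm)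
  have dist_D: "norm (X s - agreement v) \<le> B_D" if "s \<ge> 1" "v \<in> DD" for s v
  proof -
    have "norm (X s - agreement v) \<le> sqrt (\<Sum>i\<in>(UNIV :: 'a set). (diameter DD)\<^sup>2)"
      using diameter_bounded_bound[OF D_bounded] feasible[OF that(1)] that(2)
      by (intro norm_vec_le) (auto simp: X_def dist_norm)
    also have "\<dots> = B_D"
      using diameter_ge_0[OF D_bounded] by (simp only: const_stack) (simp add: B_D real_sqrt_mult)
    finally show ?thesis .
  qed
  have dist_z: "norm (Z s - agreement p) \<le> 2 * B_z" if "s \<ge> 1" "p \<in> Zr" for s p
  proof -
    have "norm ((Z s - agreement p) $ i) \<le> 2 * r" for i
      using z_norm[OF that(1), of i] that(2) norm_triangle_ineq4[of "z s i" p]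
      by (auto simp: Z_def Zr_def)
    then have "norm (Z s - agreement p) \<le> sqrt (\<Sum>i\<in>(UNIV :: 'a set). (2 * r)\<^sup>2)"
      by (rule norm_vec_le)
    also have "\<dots> = 2 * B_z"
      using r by (simp only: const_stack) (simp add: B_z real_sqrt_mult)
    finally show ?thesis .
  qed
  \<comment> \<open>Measuring the disagreement from the agreement at 0 instead of an arbitrary point
    of the ball avoids the factor 2 of \<open>dist_z\<close>.\<close>
  have "norm (Z 1) \<le> sqrt (\<Sum>i\<in>(UNIV :: 'a set). r\<^sup>2)"
    using z_norm[of 1] by (intro norm_vec_le) (simp add: Z_def)
  also have "\<dots> = B_z"
    using r by (simp only: const_stack) (simp add: B_z real_sqrt_mult)
  finally have dis_z: "norm (disagreement (Z 1)) \<le> B_z"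
    using norm_disagreement_le_norm[of "Z 1"] by linarith
  have dis_D: "norm (disagreement (X 1)) \<le> B_D"
    using norm_disagreement_le[of "X 1" Ds] dist_D[OF _ Ds, of 1] by simp
  have B_nonneg: "0 \<le> B_D" "0 \<le> B_z"
    using diameter_ge_0[OF D_bounded] r by (auto simp: B_D B_z N)

  \<comment> \<open>Regret of the three blocks\<close>
  define \<Delta>X where "\<Delta>X = (\<Sum>s=1..T. norm (disagreement (X s)))"
  define \<Delta>Z where "\<Delta>Z = (\<Sum>s=1..T. norm (disagreement (Z s)))"
  have regret_w: "(\<Sum>s=1..T. qw s \<bullet> (Y s - (\<chi> i. u i))) \<le> sqrt T * (B_w\<^sup>2 / 2 + sqrt 2 * H_w\<^sup>2)"
    if "\<And>i. u i \<in> W i" for u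
  proof -
    have "(\<Sum>s=1..T. qw s \<bullet> (Y s - (\<chi> i. u i)))
        \<le> sqrt T * (B_w\<^sup>2 / 2 + sqrt 2 * H_w\<^sup>2) + H_w * (\<Sum>s=1..T. norm (Y s - Y s))"
      by (rule doubling_trick_regret[where C = W, OF _ _ _ _ learning_rates])
        (use W_convex W_closed that qw_norm w_step dist_w T in auto)
    then show ?thesis
      by simp
  qed
  have regret_D: "(\<Sum>s=1..T. qD s \<bullet> (X s - agreement v)) + 2 * H_D * \<Delta>X
      \<le> sqrt T * (B_D\<^sup>2 / 2 + sqrt 2 * H_D\<^sup>2 + 2 * H_D * Cu * (B_D + 2 * sqrt 2 * H_D))"
    if "v \<in> DD" for v
    unfolding \<Delta>X_def Cu_def
    by (rule consensus_regret[where P = P and C = DD, OF P_ds P_diag P_pos \<delta>t_range B_pos P_connected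
          D_convex D_closed that learning_rates qD_norm H_nonneg(2) _ D_step dist_D dis_D T(1)])
      (use feasible that in \<open>auto simp: X_def\<close>)
  have regret_z: "(\<Sum>s=1..T. - G (w s) (D s) \<bullet> (Z s - agreement p)) + 2 * H_z * \<Delta>Z
      \<le> sqrt T * ((2 * B_z)\<^sup>2 / 2 + sqrt 2 * H_z\<^sup>2 + 2 * H_z * Cu * (B_z + 2 * sqrt 2 * H_z))"
    if "p \<in> Zr" for p
    unfolding \<Delta>Z_def Cu_def
    by (rule consensus_regret[where P = P and C = Zr, OF P_ds P_diag P_pos \<delta>t_range B_pos P_connected
          Zr that learning_rates _ H_nonneg(3) _ z_step dist_z dis_z T(1)])
      (use feasible that G_norm in \<open>auto simp: Z_def\<close>)
  have alpha_D: "B_w\<^sup>2 / 2 + sqrt 2 * H_w\<^sup>2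
      + (B_D\<^sup>2 / 2 + sqrt 2 * H_D\<^sup>2 + 2 * H_D * Cu * (B_D + 2 * sqrt 2 * H_D)) \<le> \<alpha>_wD / 2"
    unfolding \<alpha>_wD Cu_def[symmetric]
    using B_nonneg H_nonneg Cu \<sigma>\<Lambda> by (intro alpha_const_ge) auto
  have alpha_z: "(2 * B_z)\<^sup>2 / 2 + sqrt 2 * H_z\<^sup>2 + 2 * H_z * Cu * (B_z + 2 * sqrt 2 * H_z) \<le> \<alpha>_\<mu>z / 2"
    using alpha_const_ge[of B_z H_z Cu \<sigma> \<Lambda> 0 B_\<mu> "2 * B_z" H_\<mu>] B_nonneg H_nonneg Cu \<sigma>\<Lambda>
    unfolding \<alpha>_\<mu>z Cu_def[symmetric] by (simp add: B_\<mu> H_\<mu>)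
  define bound where "bound = sqrt T * ((\<alpha>_wD + \<alpha>_\<mu>z) / 2)"
  have regret_total: "(\<Sum>s=1..T. qw s \<bullet> (Y s - (\<chi> i. u i)))
      + ((\<Sum>s=1..T. qD s \<bullet> (X s - agreement v)) + 2 * H_D * \<Delta>X)
      + ((\<Sum>s=1..T. - G (w s) (D s) \<bullet> (Z s - agreement p)) + 2 * H_z * \<Delta>Z) \<le> bound"
    if "\<And>i. u i \<in> W i" "v \<in> DD" "p \<in> Zr" for u v p
  proof -
    have "sqrt T * (B_w\<^sup>2 / 2 + sqrt 2 * H_w\<^sup>2
        + (B_D\<^sup>2 / 2 + sqrt 2 * H_D\<^sup>2 + 2 * H_D * Cu * (B_D + 2 * sqrt 2 * H_D)))
        + sqrt T * ((2 * B_z)\<^sup>2 / 2 + sqrt 2 * H_z\<^sup>2 + 2 * H_z * Cu * (B_z + 2 * sqrt 2 * H_z))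
        \<le> sqrt T * (\<alpha>_wD / 2) + sqrt T * (\<alpha>_\<mu>z / 2)"
      by (intro add_mono mult_left_mono alpha_D alpha_z) auto
    also have "\<dots> = bound"
      by (simp add: bound_def algebra_simps)
    finally show ?thesis
      using regret_w[OF that(1)] regret_D[OF that(2)] regret_z[OF that(3)]
      by (simp only: distrib_left)
  qed

  \<comment> \<open>The averages, their means, and \<open>phi\<close> under averaging\<close>
  define wav where "wav = time_avg w t"
  define Dav where "Dav = time_avg D t"
  define zav where "zav = time_avg z t"
  have wav: "wav i \<in> W i" and Dav: "Dav i \<in> DD" and zav: "zav i \<in> Zr" for i
    unfolding wav_def Dav_def zav_def
    using feasible W_convex D_convex Zr t by (auto intro!: time_avg_in_convex)
  have Xav: "(\<chi> i. Dav i) = (1 / real T) *\<^sub>R (\<Sum>s=1..T. X s)"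
    and Zav: "(\<chi> i. zav i) = (1 / real T) *\<^sub>R (\<Sum>s=1..T. Z s)"
    by (simp_all add: Dav_def zav_def time_avg_def X_def Z_def T_def vec_eq_iff)
  define dbar where "dbar = mean (\<chi> i. Dav i)"
  define zbar where "zbar = mean (\<chi> i. zav i)"
  have dbar: "dbar \<in> DD" and zbar: "zbar \<in> Zr"
    unfolding dbar_def zbar_def using D_convex Zr(1) Dav zav by (auto intro!: mean_in_convex)
  have dis_Xav: "T * norm (disagreement (\<chi> i. Dav i)) \<le> \<Delta>X"
    and dis_Zav: "T * norm (disagreement (\<chi> i. zav i)) \<le> \<Delta>Z"
    unfolding Xav Zav \<Delta>X_def \<Delta>Z_def by (intro norm_disagreement_average_le T)+
  have Dav_split: "(\<chi> i. Dav i) = agreement dbar + disagreement (\<chi> i. Dav i)"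
    and zav_split: "(\<chi> i. zav i) = agreement zbar + disagreement (\<chi> i. zav i)"
    by (simp_all add: disagreement_def dbar_def zbar_def)
  let ?phi = "phi f g" and ?L = "lagrangian f g ws Ds zs"
  have phi_agreement: "?phi u (\<lambda>i. v) (\<lambda>i. y) = lagrangian f g u v y" for u v y
    by (simp add: phi_def lagrangian_def)
  have phi_dual: "?phi u v y - ?phi u v y' = G u v \<bullet> ((\<chi> i. y i) - (\<chi> i. y' i))" for u v y y'
  proof -
    have "G u v \<bullet> ((\<chi> i. y i) - (\<chi> i. y' i)) = (\<Sum>i\<in>UNIV. g i (u i) (v i) \<bullet> (y i - y' i))"
      by (subst inner_vec_def) (simp add: G_def)
    then show ?thesis
      unfolding phi_def sum_subtractf[symmetric]
      by (simp add: inner_diff_right inner_diff_left inner_commute)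
  qed
  have phi_subgradient: "?phi (w s) (D s) (z s) - ?phi u v (z s)
      \<le> qw s \<bullet> (Y s - (\<chi> i. u i)) + qD s \<bullet> (X s - (\<chi> i. v i))"
    if s: "s \<ge> 1" and u: "\<And>i. u i \<in> W i" for s u v
  proof -
    have "f i (w s i) (D s i) + z s i \<bullet> g i (w s i) (D s i) + qw s $ i \<bullet> (u i - w s i)
        + qD s $ i \<bullet> (v i - D s i)
        \<le> f i (u i) (v i) + z s i \<bullet> g i (u i) (v i)" for i
      unfolding qw_def qD_def vec_lambda_beta
      by (rule agent_subgradient[OF joint_subgradients[OF s] z_nonneg[OF s] W_coord[OF u]])
    then have "(\<Sum>i\<in>UNIV. f i (w s i) (D s i) + z s i \<bullet> g i (w s i) (D s i)
        - (f i (u i) (v i) + z s i \<bullet> g i (u i) (v i)))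
        \<le> (\<Sum>i\<in>UNIV. qw s $ i \<bullet> (w s i - u i) + qD s $ i \<bullet> (D s i - v i))"
      by (intro sum_mono) (simp add: inner_diff_right algebra_simps)
    then show ?thesis
      by (simp add: phi_def inner_vec_def[of "qw s"] inner_vec_def[of "qD s"] X_def Y_def
          sum.distrib sum_subtractf)
  qed
  have phi_jensen: "T * ?phi wav Dav y \<le> (\<Sum>s=1..T. ?phi (w s) (D s) y)"
    if "\<And>i. y i \<in> nonneg_orthant" for y
  proof -
    have "f i (wav i) (Dav i) + y i \<bullet> g i (wav i) (Dav i)
        \<le> (\<Sum>s=1..T. 1 / T * (f i (w s i) (D s i) + y i \<bullet> g i (w s i) (D s i)))" for i
    proof -
      let ?h = "\<lambda>p. (case p of (u, v) \<Rightarrow> f i u v) + y i \<bullet> (case p of (u, v) \<Rightarrow> g i u v)"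
      have "convex_on (coord_space (K i) \<times> UNIV) ?h"
        using f_convex g_convex that
        by (intro convex_on_weighted) (auto simp: case_prod_unfold)
      then have "?h (\<Sum>s=1..T. (1 / T) *\<^sub>R (w s i, D s i)) \<le> (\<Sum>s=1..T. 1 / T * ?h (w s i, D s i))"
        using T feasible W_coord by (intro convex_on_sum) auto
      moreover have "(\<Sum>s=1..T. (1 / T) *\<^sub>R (w s i, D s i)) = (wav i, Dav i)"
        by (simp add: prod_eq_iff fst_sum snd_sum wav_def Dav_def time_avg_def T_def scaleR_sum_right)
      ultimately show ?thesis
        by simp
    qed
    then have "?phi wav Dav y
        \<le> (\<Sum>i\<in>UNIV. \<Sum>s=1..T. 1 / T * (f i (w s i) (D s i) + y i \<bullet> g i (w s i) (D s i)))"
      unfolding phi_def by (rule sum_mono)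
    also have "\<dots> = 1 / T * (\<Sum>s=1..T. ?phi (w s) (D s) y)"
      unfolding phi_def sum_distrib_left by (rule sum.swap)
    finally show ?thesis
      using T by (simp add: field_simps)
  qed
  \<comment> \<open>\<open>phi\<close> is affine in the dual stack, so averaging over
    \<open>z\<close> loses nothing at a fixed primal point.\<close>
  have phi_linear: "(\<Sum>s=1..T. ?phi u v (z s)) = T * ?phi u v zav" for u v
  proof -
    have "(\<Sum>s=1..T. ?phi u v (z s) - ?phi u v zav) = (\<Sum>s=1..T. G u v \<bullet> (Z s - (\<chi> i. zav i)))"
      by (simp add: phi_dual Z_def)
    also have "\<dots> = G u v \<bullet> ((\<Sum>s=1..T. Z s) - T *\<^sub>R (\<chi> i. zav i))"
      by (simp add: sum_subtractf inner_diff_right sum_constant_scaleR flip: inner_sum_right)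
    also have "\<dots> = 0"
      using T by (simp add: Zav)
    finally show ?thesis
      by (simp add: sum_subtractf)
  qed
  \<comment> \<open>The subgradients are taken at \<open>dbar\<close>, since there they bound the
    values at \<open>Dav i\<close> from below, which is the direction needed.\<close>
  have phi_lipschitz: "?phi wav (\<lambda>i. dbar) (\<lambda>i. zs) - ?phi wav Dav (\<lambda>i. zs)
      \<le> H_D * norm (disagreement (\<chi> i. Dav i))"
  proof -
    have "\<exists>q. norm q \<le> h_D \<and> (\<forall>v'. f i (wav i) dbar + zs \<bullet> g i (wav i) dbar + q \<bullet> (v' - dbar)
        \<le> f i (wav i) v' + zs \<bullet> g i (wav i) v')" for i
      unfolding h_D_def
      by (rule agent_snd_subgradient_exists[OF f_convex g_convex W_coord[OF wav]
            bound_fD[OF wav dbar] bound_gD[OF wav dbar] zs_nonneg]) (use zs in \<open>auto simp: Zr_def\<close>)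
    then obtain q where q: "\<And>i. norm (q i) \<le> h_D"
      "\<And>i v'. f i (wav i) dbar + zs \<bullet> g i (wav i) dbar + q i \<bullet> (v' - dbar)
        \<le> f i (wav i) v' + zs \<bullet> g i (wav i) v'"
      by metis
    have "(\<Sum>i\<in>UNIV. (f i (wav i) dbar + zs \<bullet> g i (wav i) dbar)
          - (f i (wav i) (Dav i) + zs \<bullet> g i (wav i) (Dav i)))
        \<le> (\<Sum>i\<in>UNIV. - q i \<bullet> (Dav i - dbar))"
      using q(2)[of _ "Dav _"] by (intro sum_mono) (simp add: algebra_simps)
    then have "?phi wav (\<lambda>i. dbar) (\<lambda>i. zs) - ?phi wav Dav (\<lambda>i. zs)
        \<le> (\<chi> i. - q i) \<bullet> disagreement (\<chi> i. Dav i)"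
      by (simp add: phi_def sum_subtractf inner_vec_def[of "vec_lambda _"] disagreement_def
          flip: dbar_def)
    also have "\<dots> \<le> norm (\<chi> i. - q i) * norm (disagreement (\<chi> i. Dav i))"
      by (rule norm_cauchy_schwarz)
    also have "\<dots> \<le> H_D * norm (disagreement (\<chi> i. Dav i))"
    proof (rule mult_right_mono)
      show "norm (\<chi> i. - q i) \<le> H_D"
        using norm_vec_le[of "\<chi> i. - q i" "\<lambda>i. h_D"] q(1)
        by (simp only: const_stack H_D h_D_def vec_lambda_beta norm_minus_cancel)
    qed simp
    finally show ?thesis .
  qed

  \<comment> \<open>The two one-sided estimates\<close>
  have upper: "T * (?phi wav Dav zav - ?L) \<le> bound"
  proof -
    have G_dis: "G u v \<bullet> disagreement (\<chi> i. zav i) \<le> H_z * norm (disagreement (\<chi> i. zav i))"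
      if "\<And>i. u i \<in> W i" "\<And>i. v i \<in> DD" for u v
      by (rule order_trans[OF norm_cauchy_schwarz mult_right_mono[OF G_norm[OF that]]]) auto
    \<comment> \<open>\<open>zav\<close> is exchanged for the agreeing \<open>zbar\<close> twice: at
      the iterates, because the regret estimate compares with agreements, and at
      \<open>(ws, Ds)\<close>, because the saddle inequality does. This spends the reserve
      \<open>2 * H_z * \<Delta>Z\<close>.\<close>
    have "T * ?phi wav Dav zav \<le> (\<Sum>s=1..T. ?phi (w s) (D s) zav)"
      using zav by (intro phi_jensen) (auto simp: Zr_def)
    also have "\<dots> \<le> (\<Sum>s=1..T. ?phi ws (\<lambda>i. Ds) (z s) + qw s \<bullet> (Y s - (\<chi> i. ws i))
        + qD s \<bullet> (X s - agreement Ds) + (- G (w s) (D s)) \<bullet> (Z s - agreement zbar)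
        + H_z * norm (disagreement (\<chi> i. zav i)))"
    proof (rule sum_mono)
      fix s assume "s \<in> {1..T}"
      then have s: "s \<ge> 1"
        by simp
      have "?phi (w s) (D s) zav - ?phi (w s) (D s) (z s)
          = G (w s) (D s) \<bullet> (agreement zbar + disagreement (\<chi> i. zav i) - Z s)"
        unfolding phi_dual zav_split[symmetric] by (simp add: Z_def)
      also have "\<dots>
          = (- G (w s) (D s)) \<bullet> (Z s - agreement zbar) + G (w s) (D s) \<bullet> disagreement (\<chi> i. zav i)"
        by (simp add: inner_diff_right inner_add_right)
      also have "G (w s) (D s) \<bullet> disagreement (\<chi> i. zav i) \<le> H_z * norm (disagreement (\<chi> i. zav i))"
        using feasible[OF s] by (intro G_dis) auto
      finally show "?phi (w s) (D s) zav \<le> ?phi ws (\<lambda>i. Ds) (z s) + qw s \<bullet> (Y s - (\<chi> i. ws i))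
        + qD s \<bullet> (X s - agreement Ds) + (- G (w s) (D s)) \<bullet> (Z s - agreement zbar)
        + H_z * norm (disagreement (\<chi> i. zav i))"
        using phi_subgradient[OF s ws, of "\<lambda>i. Ds"] by (simp add: agreement_def)
    qed
    also have "\<dots> = T * ?phi ws (\<lambda>i. Ds) zav + (\<Sum>s=1..T. qw s \<bullet> (Y s - (\<chi> i. ws i)))
        + (\<Sum>s=1..T. qD s \<bullet> (X s - agreement Ds)) + (\<Sum>s=1..T. (- G (w s) (D s)) \<bullet> (Z s - agreement zbar))
        + H_z * (T * norm (disagreement (\<chi> i. zav i)))"
      unfolding sum.distrib phi_linear by simp
    also have "T * ?phi ws (\<lambda>i. Ds) zav \<le> T * (?L + H_z * norm (disagreement (\<chi> i. zav i)))"
    proof -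
      have "?phi ws (\<lambda>i. Ds) zav - ?phi ws (\<lambda>i. Ds) (\<lambda>i. zbar)
          = G ws (\<lambda>i. Ds) \<bullet> disagreement (\<chi> i. zav i)"
        unfolding phi_dual by (simp add: disagreement_def agreement_def zbar_def)
      also have "\<dots> \<le> H_z * norm (disagreement (\<chi> i. zav i))"
        by (rule G_dis[OF ws Ds])
      finally have "?phi ws (\<lambda>i. Ds) zav
          \<le> lagrangian f g ws Ds zbar + H_z * norm (disagreement (\<chi> i. zav i))"
        by (simp add: phi_agreement)
      moreover have "lagrangian f g ws Ds zbar \<le> ?L"
        using saddle zbar by (auto simp: saddle_point_def Zr_def)
      ultimately show ?thesis
        by (intro mult_left_mono) auto
    qed
    finally have "T * (?phi wav Dav zav - ?L) \<le> (\<Sum>s=1..T. qw s \<bullet> (Y s - (\<chi> i. ws i)))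
        + (\<Sum>s=1..T. qD s \<bullet> (X s - agreement Ds)) + (\<Sum>s=1..T. (- G (w s) (D s)) \<bullet> (Z s - agreement zbar))
        + 2 * H_z * (T * norm (disagreement (\<chi> i. zav i)))"
      by (simp add: algebra_simps)
    moreover have "2 * H_z * (T * norm (disagreement (\<chi> i. zav i))) \<le> 2 * H_z * \<Delta>Z"
      using dis_Zav H_nonneg by (intro mult_left_mono) auto
    moreover have "0 \<le> 2 * H_D * \<Delta>X"
      unfolding \<Delta>X_def using H_nonneg by (intro mult_nonneg_nonneg sum_nonneg) auto
    ultimately show ?thesis
      using regret_total[OF ws Ds zbar] by linarith
  qed
  have lower: "T * (?L - ?phi wav Dav zav) \<le> bound"
  proof -
    \<comment> \<open>The comparison point is the primal average itself, known only in hindsight;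
      this is legitimate because \<open>regret_total\<close> holds for every feasible comparison
      point. \<open>Dav\<close> is exchanged for \<open>dbar\<close> once in the linear term here
      and once through \<open>phi_lipschitz\<close>, which spends
      \<open>2 * H_D * \<Delta>X\<close>.\<close>
    have "(\<Sum>s=1..T. ?phi (w s) (D s) (\<lambda>i. zs) - (qw s \<bullet> (Y s - (\<chi> i. wav i))
        + qD s \<bullet> (X s - agreement dbar)
        + (- G (w s) (D s)) \<bullet> (Z s - agreement zs) + H_D * norm (disagreement (\<chi> i. Dav i))))
        \<le> (\<Sum>s=1..T. ?phi wav Dav (z s))"
    proof (rule sum_mono)
      fix s assume "s \<in> {1..T}"
      then have s: "s \<ge> 1"
        by simp
      have "qD s \<bullet> (X s - (\<chi> i. Dav i))
          = qD s \<bullet> (X s - agreement dbar) + (- qD s) \<bullet> disagreement (\<chi> i. Dav i)"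
        by (subst Dav_split) (simp add: inner_diff_right inner_add_right)
      also have "(- qD s) \<bullet> disagreement (\<chi> i. Dav i) \<le> H_D * norm (disagreement (\<chi> i. Dav i))"
        using qD_norm[OF s] by (intro order_trans[OF norm_cauchy_schwarz mult_right_mono]) auto
      finally have "qD s \<bullet> (X s - (\<chi> i. Dav i))
          \<le> qD s \<bullet> (X s - agreement dbar) + H_D * norm (disagreement (\<chi> i. Dav i))"
        by simp
      moreover have "?phi (w s) (D s) (\<lambda>i. zs) - ?phi (w s) (D s) (z s)
          = (- G (w s) (D s)) \<bullet> (Z s - agreement zs)"
        unfolding phi_dual by (simp add: Z_def agreement_def inner_diff_right)
      ultimately show "?phi (w s) (D s) (\<lambda>i. zs) - (qw s \<bullet> (Y s - (\<chi> i. wav i))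
          + qD s \<bullet> (X s - agreement dbar)
          + (- G (w s) (D s)) \<bullet> (Z s - agreement zs) + H_D * norm (disagreement (\<chi> i. Dav i)))
          \<le> ?phi wav Dav (z s)"
        using phi_subgradient[OF s wav, of Dav] by linarith
    qed
    then have "(\<Sum>s=1..T. ?phi (w s) (D s) (\<lambda>i. zs)) \<le> T * ?phi wav Dav zav
        + (\<Sum>s=1..T. qw s \<bullet> (Y s - (\<chi> i. wav i))) + (\<Sum>s=1..T. qD s \<bullet> (X s - agreement dbar))
        + (\<Sum>s=1..T. (- G (w s) (D s)) \<bullet> (Z s - agreement zs)) + H_D * (T * norm (disagreement (\<chi> i. Dav i)))"
      unfolding sum_subtractf sum.distrib phi_linear by (simp add: algebra_simps)
    moreover have "T * (?L - H_D * norm (disagreement (\<chi> i. Dav i)))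
        \<le> (\<Sum>s=1..T. ?phi (w s) (D s) (\<lambda>i. zs))"
    proof -
      have "?L \<le> lagrangian f g wav dbar zs"
        using saddle wav dbar by (auto simp: saddle_point_def)
      then have "?L - H_D * norm (disagreement (\<chi> i. Dav i)) \<le> ?phi wav Dav (\<lambda>i. zs)"
        using phi_lipschitz by (simp add: phi_agreement)
      then have "T * (?L - H_D * norm (disagreement (\<chi> i. Dav i))) \<le> T * ?phi wav Dav (\<lambda>i. zs)"
        by (rule mult_left_mono) simp
      also have "\<dots> \<le> (\<Sum>s=1..T. ?phi (w s) (D s) (\<lambda>i. zs))"
        using zs_nonneg by (rule phi_jensen)
      finally show ?thesis .
    qed
    ultimately have "T * (?L - ?phi wav Dav zav) \<le> (\<Sum>s=1..T. qw s \<bullet> (Y s - (\<chi> i. wav i)))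
        + (\<Sum>s=1..T. qD s \<bullet> (X s - agreement dbar)) + (\<Sum>s=1..T. (- G (w s) (D s)) \<bullet> (Z s - agreement zs))
        + 2 * H_D * (T * norm (disagreement (\<chi> i. Dav i)))"
      by (simp add: algebra_simps)
    moreover have "2 * H_D * (T * norm (disagreement (\<chi> i. Dav i))) \<le> 2 * H_D * \<Delta>X"
      using dis_Xav H_nonneg by (intro mult_left_mono) auto
    moreover have "0 \<le> 2 * H_z * \<Delta>Z"
      unfolding \<Delta>Z_def using H_nonneg by (intro mult_nonneg_nonneg sum_nonneg) auto
    ultimately show ?thesis
      using regret_total[OF wav dbar zs] by linarith
  qed
  have "sqrt T / T = inverse (sqrt T)"
    by (rule sqrt_divide_self_eq) simp
  then have "bound / T = inverse (sqrt T) * ((\<alpha>_wD + \<alpha>_\<mu>z) / 2)"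
    unfolding bound_def by (simp only: times_divide_eq_left[symmetric])
  then have bound: "bound / T = (\<alpha>_wD + \<alpha>_\<mu>z) / (2 * sqrt T)"
    by (simp only: divide_inverse inverse_mult_distrib mult_ac)
  have neg: "- (\<alpha>_\<mu>z + \<alpha>_wD) / (2 * sqrt T) = - (bound / T)"
    unfolding bound by (simp only: minus_divide_left add.commute)
  have "?phi wav Dav zav - ?L \<le> bound / T" "?L - ?phi wav Dav zav \<le> bound / T"
    using upper lower T(2) by (simp_all only: pos_le_divide_eq mult.commute[of _ "real T"])
  then show ?thesis
    unfolding T_def[symmetric] wav_def[symmetric] Dav_def[symmetric] zav_def[symmetric]
      neg bound[symmetric]
    by (intro conjI) linarith+
qed

end
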